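(* Let $A\in\mathbb{C}^{n\times n}$, $B\in\mathbb{C}^{m\times n}$, $C\in\mathbb{C}^{n\times m}$, $D\in\mathbb{C}^{m\times m}$, with $M,S,s,Z,z,E,M_E$ as in the context. Suppose that at least one of the following conditions holds: (1) $M_E^\#$ exists, and $M_E^e=E$; (2) $s^\#$ exists, and $s^e=A^e$; (3) $z^\#$ exists, and $z^e=D^e$; (4) $A^\pi+s$ is invertible; (5) $I+A^d(s-A)$ is invertible (or $I+A^d(S-I)A$ is invertible); (6) $s^d=(I+A^d(s-A))^{-1}A^d$; (7) $D^\pi+z$ is invertible; (8) $I+D^d(z-D)$ is invertible (or $I+D^d(Z-I)D$ is invertible); (9) $z^d=(I+D^d(z-D))^{-1}D^d$; (10) $s^\#,z^\#$ exist, $s^\#=A^dCz^\#BA^d+A^d$, and $A^dCz^\#=s^\#CD^d$; (11) $s^\#,z^\#$ exist, $z^\#=D^dBs^\#CD^d+D^d$, and $D^dBs^\#=z^\#BA^d$; (12) $M_E^\#$ exists, and $M_E^\#=\begin{bmatrix}A^d+A^dCz^\#BA^d&-A^dCz^\#\\ -z^\#BA^d&z^\#\end{bmatrix}=\begin{bmatrix}s^\#&-s^\#CD^d\\ -D^dBs^\#&D^dBs^\#CD^d+D^d\end{bmatrix}$. If moreover $ACD^\pi=0$ and $DBA^\pi=0$, then $$\begin{aligned}M^d={}&\left(\begin{bmatrix}(CBA^\pi)^\pi&0\\ 0&(BCD^\pi)^\pi\end{bmatrix}-\sum_{m=1}^{t-1}\begin{bmatrix}0&(CBA^\pi)^dCD^\pi\\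 BA^\pi(CBA^\pi)^d&0\end{bmatrix}^m\begin{bmatrix}A^mA^\pi&0\\ 0&D^mD^\pi\end{bmatrix}\right)\\ &\times\sum_{i=0}^{r-1}\begin{bmatrix}AA^\pi&CD^\pi\\ BA^\pi&DD^\pi\end{bmatrix}^i\left(I+\begin{bmatrix}0&A^\pi CD^e\\ D^\pi BA^e&0\end{bmatrix}P_1^\#\right)(P_1^\#)^{i+1}\\ &+\left(\begin{bmatrix}0&(CBA^\pi)^dCD^\pi\\ BA^\pi(CBA^\pi)^d&0\end{bmatrix}+\sum_{n=1}^{t-1}\begin{bmatrix}0&(CBA^\pi)^dCD^\pi\\ BA^\pi(CBA^\pi)^d&0\end{bmatrix}^{n+1}\begin{bmatrix}A^nA^\pi&0\\ 0&D^nD^\pi\end{bmatrix}\right)\\ &\times\left(\begin{bmatrix}A^\pi&0\\ 0&D^\pi\end{bmatrix}-\begin{bmatrix}0&A^\pi CD^e\\ D^\pi BA^e&0\end{bmatrix}P_1^\#\right),\end{aligned}$$ where $t=\max\{\mathrm{ind}(A),\mathrm{ind}(D)\}$, $r=\mathrm{ind}\left(\begin{bmatrix}AA^\pi&CD^\pi\\ BA^\pi&DD^\pi\end{bmatrix}\right)$, and $$P_1^\#=\begin{bmatrix}A^d+A^dCz^\#BA^d&-A^dCz^\#\\ -z^\#BA^d&z^\#\end{bmatrix}=\begin{bmatrix}s^\#&-s^\#CD^d\\ -D^dBs^\#&D^dBs^\#CD^d+D^d\end{bmatrix}.$$ (The summation indices $m,n$ are local and unrelated to the matrix sizes.)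
   Context: All matrices are complex; $I$ is an identity matrix of the proper size. For a square matrix $X$: the Drazin inverse $X^d$ is the unique matrix with $XX^d=X^dX$, $X^dXX^d=X^d$, $X^k=X^{k+1}X^d$, where $k=\mathrm{ind}(X)$ is the smallest non-negative integer with $\mathrm{rank}(X^k)=\mathrm{rank}(X^{k+1})$ (it always exists). The group inverse $X^\#$, when it exists, is the unique matrix with $XX^\#X=X$, $X^\#XX^\#=X^\#$, $XX^\#=X^\#X$. Put $X^e=XX^d$, $X^\pi=I-X^e$, $X^0=I$. A sum whose upper limit is smaller than its lower limit is $0$. An equation containing a group inverse or an ordinary inverse includes the assertion that it exists. Notation: $S=A-CD^dB$, $s=A^eSA^e$, $Z=D-BA^dC$, $z=D^eZD^e$, $M=\begin{bmatrix}A&C\\ B&D\end{bmatrix}$, $E=\begin{bmatrix}A^e&0\\ 0&D^e\end{bmatrix}$, $M_E=EME=\begin{bmatrix}AA^e&A^eCD^e\\ D^eBA^e&DD^e\end{bmatrix}$. The matrix $P_1$ is $P_1=M_E$. *)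

theory Defs
  imports "HOL-Analysis.Analysis"
begin

text \<open>
  A complex matrix with \<open>m\<close> rows and \<open>n\<close> columns has type \<open>complex^'n^'m\<close>: the type of the column
  index comes first. All products are \<open>**\<close>; the class operation \<open>*\<close> on vectors plays no role.
\<close>

primrec mat_pow :: "complex^'n^'n \<Rightarrow> nat \<Rightarrow> complex^'n^'n" where
  "mat_pow X 0 = mat 1"
| "mat_pow X (Suc k) = X ** mat_pow X k"

definition mat_ind :: "complex^'n^'n \<Rightarrow> nat" where
  "mat_ind X = (LEAST k. rank (mat_pow X k) = rank (mat_pow X (Suc k)))"

definition is_drazin_inv :: "complex^'n^'n \<Rightarrow> complex^'n^'n \<Rightarrow> bool" where
  "is_drazin_inv X Y \<longleftrightarrow>
     X ** Y = Y ** X \<and>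
     Y ** X ** Y = Y \<and>
     mat_pow X (mat_ind X) = mat_pow X (mat_ind X + 1) ** Y"

definition drazin_inv :: "complex^'n^'n \<Rightarrow> complex^'n^'n"  (\<open>(_\<^sup>d)\<close> [1000] 1000) where
  "X\<^sup>d = (THE Y. is_drazin_inv X Y)"

definition drazin_e :: "complex^'n^'n \<Rightarrow> complex^'n^'n"  (\<open>(_\<^sup>e)\<close> [1000] 1000) where
  "X\<^sup>e = X ** X\<^sup>d"

definition drazin_pi :: "complex^'n^'n \<Rightarrow> complex^'n^'n"  (\<open>(_\<^sup>\<pi>)\<close> [1000] 1000) where
  "X\<^sup>\<pi> = mat 1 - X\<^sup>e"

definition is_group_inv :: "complex^'n^'n \<Rightarrow> complex^'n^'n \<Rightarrow> bool" where
  "is_group_inv X Y \<longleftrightarrow> X ** Y ** X = X \<and> Y ** X ** Y = Y \<and> X ** Y = Y ** X"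

definition group_invertible :: "complex^'n^'n \<Rightarrow> bool" where
  "group_invertible X \<longleftrightarrow> (\<exists>Y. is_group_inv X Y)"

text \<open>
  Unlike the Drazin inverse, the group inverse need not exist. The value below is meaningful only
  if \<open>group_invertible X\<close> holds, so an equation that contains \<open>X\<^sup>#\<close> has to be accompanied by that
  assertion; likewise \<open>matrix_inv X\<close> by \<open>invertible X\<close>.
\<close>

definition group_inv :: "complex^'n^'n \<Rightarrow> complex^'n^'n"  (\<open>(_\<^sup>#)\<close> [1000] 1000) where
  "X\<^sup># = (THE Y. is_group_inv X Y)"

text \<open>
  \<open>block_mat A C B D\<close> is the matrix with first block row \<open>A, C\<close> and second block row \<open>B, D\<close>,
  with rows indexed by \<open>'p + 'q\<close> and columns by \<open>'n + 'm\<close>.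
\<close>

definition block_mat ::
  "complex^'n^'p \<Rightarrow> complex^'m^'p \<Rightarrow> complex^'n^'q \<Rightarrow> complex^'m^'q \<Rightarrow> complex^('n + 'm)^('p + 'q)"
  where
  "block_mat A C B D = (\<chi> i j.
     case i of
       Inl k \<Rightarrow> (case j of Inl l \<Rightarrow> A $ k $ l | Inr l \<Rightarrow> C $ k $ l)
     | Inr k \<Rightarrow> (case j of Inl l \<Rightarrow> B $ k $ l | Inr l \<Rightarrow> D $ k $ l))"

end

theory Submission
  imports Defs
begin

text \<open>
  Each of the conditions (1)--(12) says that the compression \<open>P\<^sub>1\<close> of \<open>M\<close> to the range of the
  idempotent \<open>E\<close> is invertible in that corner, equivalently that one of the Schur complements \<open>s\<close>,
  \<open>z\<close> is invertible in the corner of \<open>A\<^sup>e\<close>, \<open>D\<^sup>e\<close>. The hypotheses \<open>A C D\<^sup>\<pi> = 0\<close> and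
  \<open>D B A\<^sup>\<pi> = 0\<close> say that \<open>E M (1 - E) = 0\<close>, so that \<open>M = P\<^sub>1 + N + G\<close> is block triangular for
  the decomposition given by \<open>E\<close>, and \<open>M\<^sup>d\<close> is expressed through \<open>P\<^sub>1\<^sup>#\<close> and \<open>G\<^sup>d\<close>. Finally
  \<open>G = K + L\<close> with \<open>K\<close> the off-diagonal part and \<open>L\<close> the nilpotent diagonal part, where
  \<open>L K = 0\<close>; this gives \<open>G\<^sup>d = (\<Sum>n. (K\<^sup>d)\<^sup>n\<^sup>+\<^sup>1 L\<^sup>n)\<close>, and \<open>K\<^sup>d\<close> follows from the block
  diagonal matrix \<open>K\<^sup>2\<close>.
\<close>

section \<open>Matrix algebra\<close>

lemma matrix_add_rdistrib: "((A + B) :: complex^'n^'m) ** C = A ** C + B ** C"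
  by (vector matrix_matrix_mult_def sum.distrib[symmetric] distrib_right)

lemma matrix_diff_ldistrib: "(A :: complex^'n^'m) ** (B - C) = A ** B - A ** C"
  by (vector matrix_matrix_mult_def sum_subtractf[symmetric] right_diff_distrib)

lemma matrix_diff_rdistrib: "((A - B) :: complex^'n^'m) ** C = A ** C - B ** C"
  by (vector matrix_matrix_mult_def sum_subtractf[symmetric] left_diff_distrib)

lemma matrix_minus_left: "(- A :: complex^'n^'m) ** B = - (A ** B)"
  using matrix_diff_rdistrib[of 0 A B] by simp

lemma matrix_minus_right: "(A :: complex^'n^'m) ** (- B) = - (A ** B)"
  using matrix_diff_ldistrib[of A 0 B] by simp

lemma matrix_sum_left: "(\<Sum>i\<in>I. f i :: complex^'n^'m) ** B = (\<Sum>i\<in>I. f i ** B)"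
  by (induction I rule: infinite_finite_induct) (simp_all add: matrix_add_rdistrib)

lemma matrix_sum_right: "(A :: complex^'n^'m) ** (\<Sum>i\<in>I. f i) = (\<Sum>i\<in>I. A ** f i)"
  by (induction I rule: infinite_finite_induct) (simp_all add: matrix_add_ldistrib)

text \<open>In right-nested products an equation for \<open>X ** Y\<close> no longer matches inside
  \<open>X ** (Y ** W)\<close>. Instances made with \<open>THEN\<close> are the missing rewrite
  rules.\<close>

lemma matrix_mul_tail:
  fixes X :: "complex^'n^'m" and Y :: "complex^'p^'n"
  shows "X ** Y = V \<Longrightarrow> X ** (Y ** W) = V ** W"
  by (simp add: matrix_mul_assoc)

lemmas matrix_distribs = matrix_add_ldistrib matrix_add_rdistrib matrix_diff_ldistrib
  matrix_diff_rdistrib matrix_minus_left matrix_minus_right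

lemmas matrix_assoc_right = matrix_mul_assoc[symmetric]

lemma mat_pow_add: "mat_pow X (j + k) = mat_pow X j ** mat_pow X k"
  by (induction j) (simp_all add: matrix_mul_assoc)

lemma mat_pow_commute: "X ** mat_pow X k = mat_pow X k ** X"
  by (induction k) (simp_all add: matrix_mul_assoc)

lemma mat_pow_Suc_right: "mat_pow X (Suc k) = mat_pow X k ** X"
  by (simp add: mat_pow_commute)

lemma mat_pow_intertwine:
  fixes T :: "complex^'m^'n"
  assumes "X ** T = T ** Y"
  shows "mat_pow X k ** T = T ** mat_pow Y k"
proof (induction k)
  case (Suc k)
  have "mat_pow X (Suc k) ** T = X ** (mat_pow X k ** T)"
    by (simp add: matrix_mul_assoc)
  also have "\<dots> = (X ** T) ** mat_pow Y k"
    by (simp only: Suc matrix_mul_assoc)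
  finally show ?case by (simp add: assms matrix_mul_assoc)
qed simp

lemma mat_pow_transpose: "transpose (mat_pow X k) = mat_pow (transpose X) k"
  by (induction k)
    (simp_all add: matrix_transpose_mul mat_pow_commute del: mat_pow.simps(2) add: mat_pow_Suc_right)

section \<open>The index and the Drazin inverse\<close>

lemma span_rows: "vec.span (rows (A :: 'a::field^'n^'m)) = range (\<lambda>x. x v* A)"
proof (rule vec.span_unique)
  show "rows A \<subseteq> range (\<lambda>x. x v* A)"
  proof
    fix v assume "v \<in> rows A"
    then obtain i where "v = row i A"
      by (auto simp: rows_def)
    then have "v = axis i 1 v* A"
      by (simp add: vec_eq_iff vector_matrix_mult_def row_def axis_def if_distrib if_distribR
          cong: if_cong)
    then show "v \<in> range (\<lambda>x. x v* A)" by blast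
  qed
  have "0 = 0 v* A" "x v* A + y v* A = (x + y) v* A" "c *s (x v* A) = (c *s x) v* A" for x y c
    by (simp_all add: vec_eq_iff vector_matrix_mult_def sum.distrib distrib_right sum_distrib_left
        mult.assoc)
  then show "vec.subspace (range (\<lambda>x. x v* A))"
    unfolding vec.subspace_def by (metis (no_types, lifting) rangeE rangeI)
  show "range (\<lambda>x. x v* A) \<subseteq> S'" if "rows A \<subseteq> S'" "vec.subspace S'" for S'
  proof -
    have "x v* A \<in> vec.span (rows A)" for x
      using matrix_vector_mult_in_columnspace_gen[of "transpose A" x] by simp
    then show ?thesis
      using vec.span_minimal[OF that] by blast
  qed
qed

lemma span_rows_mul_subset:
  fixes A :: "'a::field^'n^'m" and V :: "'a^'m^'p"
  shows "vec.span (rows (V ** A)) \<subseteq> vec.span (rows A)"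
  by (auto simp: span_rows vector_matrix_mul_assoc[symmetric])

lemma rank_mul_le_right_field:
  fixes A :: "'a::field^'n^'m" and V :: "'a^'m^'p"
  shows "rank (V ** A) \<le> rank A"
  unfolding row_rank_def_gen
  by (metis span_rows_mul_subset vec.dim_span vec.dim_subset)

text \<open>The row space of \<open>V ** A\<close> lies in that of \<open>A\<close>, so equal
  dimensions make them coincide. Each row of \<open>A\<close> is then a combination of rows of
  \<open>V ** A\<close>, and the coefficient vectors are the rows of \<open>W\<close>.\<close>

lemma row_factor_of_rank_eq:
  fixes A :: "'a::field^'n^'m" and V :: "'a^'m^'p"
  assumes "rank (V ** A) = rank A"
  obtains W where "A = W ** (V ** A)"
proof -
  have "vec.span (rows (V ** A)) = vec.span (rows A)"
    using vec.subspace_dim_equal[OF vec.subspace_span vec.subspace_span span_rows_mul_subset] assms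
    unfolding row_rank_def_gen by (metis order_refl vec.dim_span)
  moreover have "row i A \<in> vec.span (rows A)" for i
    by (intro vec.span_base) (auto simp: rows_def)
  ultimately have "row i A \<in> range (\<lambda>x. x v* (V ** A))" for i
    by (simp add: span_rows[symmetric])
  then have "\<forall>i. \<exists>x. row i A = x v* (V ** A)"
    by blast
  then obtain w where w: "\<And>i. row i A = w i v* (V ** A)"
    by metis
  have "A $ i $ j = ((\<chi> i. w i) ** (V ** A)) $ i $ j" for i j
    using arg_cong[OF w[of i], of "\<lambda>v. v $ j"]
    by (simp add: row_def vector_matrix_mult_def matrix_matrix_mult_def)
  then have "A = (\<chi> i. w i) ** (V ** A)"
    by (simp add: vec_eq_iff)
  then show ?thesis using that by blast
qed

text \<open>Left multiplication by \<open>X\<close> cannot raise the rank, and a natural number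
  cannot drop strictly at every step. Hence the \<open>LEAST\<close> in \<open>mat_ind\<close> is
  attained.\<close>

lemma rank_mat_pow_stabilizes: "\<exists>k. rank (mat_pow X k) = rank (mat_pow X (Suc k))"
proof (rule ccontr)
  assume "\<not> ?thesis"
  then have less: "rank (mat_pow X (Suc k)) < rank (mat_pow X k)" for k
    using rank_mul_le_right_field[of X "mat_pow X k"] by (metis le_neq_implies_less mat_pow.simps(2))
  have "rank (mat_pow X k) + k \<le> rank (mat_pow X 0)" for k
  proof (induction k)
    case (Suc k)
    then show ?case using less[of k] by simp
  qed simp
  from this[of "Suc (rank (mat_pow X 0))"] show False by simp
qed

text \<open>Trades the rank condition in \<open>mat_ind\<close> for an algebraic factorization, the
  form in which the index enters the arguments about Drazin inverses.\<close>

lemma mat_ind_left_factor: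
  obtains V where "mat_pow X (mat_ind X) = V ** mat_pow X (Suc (mat_ind X))"
proof -
  have "rank (mat_pow X (mat_ind X)) = rank (mat_pow X (Suc (mat_ind X)))"
    unfolding mat_ind_def using rank_mat_pow_stabilizes by (rule LeastI_ex)
  then show ?thesis
    using that row_factor_of_rank_eq[of X "mat_pow X (mat_ind X)"] by (metis mat_pow.simps(2))
qed

section \<open>Characterization, naturality, uniqueness and existence of the Drazin inverse\<close>

lemma left_factor_iterate:
  assumes "mat_pow X k = V ** mat_pow X (Suc k)"
  shows "mat_pow X k = mat_pow V j ** mat_pow X (k + j)"
proof (induction j)
  case (Suc j)
  have "mat_pow X (k + j) = V ** mat_pow X (Suc k) ** mat_pow X j"
    using assms by (simp only: mat_pow_add)
  then have "mat_pow X (k + j) = V ** mat_pow X (k + Suc j)"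
    by (metis add_Suc_right add_Suc mat_pow_add matrix_mul_assoc)
  then show ?case
    using Suc by (metis mat_pow_Suc_right matrix_mul_assoc)
qed simp

text \<open>The power equation may be verified at any exponent \<open>j\<close>, so a candidate can
  be tested without knowing the index. The equation passes to the exponent \<open>?k + j\<close>,
  and \<open>mat_pow X ?k\<close> is a left multiple of \<open>mat_pow X (?k + j)\<close>, which
  carries it back to the index.\<close>

lemma is_drazin_invI:
  assumes comm: "X ** Y = Y ** X" and YXY: "Y ** X ** Y = Y"
    and j: "mat_pow X j = mat_pow X (Suc j) ** Y"
  shows "is_drazin_inv X Y"
proof -
  let ?k = "mat_ind X"
  obtain V where "mat_pow X ?k = V ** mat_pow X (Suc ?k)"
    by (rule mat_ind_left_factor)
  note V = left_factor_iterate[OF this, of j]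
  have "mat_pow X (?k + j) = mat_pow X ?k ** (mat_pow X j ** (X ** Y))"
    using j by (metis mat_pow_add mat_pow_Suc_right matrix_mul_assoc)
  then have "mat_pow X (?k + j) = mat_pow X (?k + j) ** (X ** Y)"
    by (simp add: mat_pow_add matrix_mul_assoc)
  with V have "mat_pow X ?k = mat_pow X ?k ** (X ** Y)"
    by (metis matrix_mul_assoc)
  then have "mat_pow X ?k = mat_pow X (?k + 1) ** Y"
    by (metis Suc_eq_plus1 mat_pow_Suc_right matrix_mul_assoc)
  with comm YXY show ?thesis by (simp add: is_drazin_inv_def)
qed

lemma is_drazin_inv_pow:
  assumes "is_drazin_inv X Y"
  shows "mat_pow X (mat_ind X + k) ** (X ** Y) = mat_pow X (mat_ind X + k)"
proof -
  have "mat_pow X (mat_ind X) ** (X ** Y) = mat_pow X (mat_ind X)"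
    using assms unfolding is_drazin_inv_def
    by (metis Suc_eq_plus1 mat_pow_Suc_right matrix_mul_assoc)
  then show ?thesis
    by (metis add.commute mat_pow_add matrix_mul_assoc)
qed

lemma is_drazin_inv_absorb:
  assumes "is_drazin_inv X Y"
  shows "mat_pow Y (Suc k) ** mat_pow X k = Y" "mat_pow X k ** mat_pow Y (Suc k) = Y"
proof -
  have *: "X ** Y = Y ** X" "Y ** X ** Y = Y"
    using assms by (auto simp: is_drazin_inv_def)
  show 1: "mat_pow Y (Suc k) ** mat_pow X k = Y" for k
  proof (induction k)
    case (Suc k)
    have "mat_pow Y (Suc (Suc k)) ** mat_pow X (Suc k)
        = Y ** (mat_pow Y (Suc k) ** mat_pow X k) ** X"
      by (simp add: mat_pow_commute matrix_mul_assoc)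
    then show ?case
      using Suc * by (metis matrix_mul_assoc)
  qed simp
  have "mat_pow X k ** Y = Y ** mat_pow X k"
    using mat_pow_intertwine[OF *(1)] .
  then have "mat_pow X k ** mat_pow Y (Suc k) = mat_pow Y (Suc k) ** mat_pow X k"
    by (metis mat_pow_intertwine)
  then show "mat_pow X k ** mat_pow Y (Suc k) = Y" using 1 by simp
qed

text \<open>Writing \<open>G\<close> as \<open>mat_pow G (Suc k) ** mat_pow X k\<close> and
  \<open>H\<close> as \<open>mat_pow Y k ** mat_pow H (Suc k)\<close>, and moving \<open>T\<close>
  past the powers, reduces both sides to \<open>G ** X ** T ** H\<close>. The case
  \<open>T = mat 1\<close> gives uniqueness; a rectangular \<open>T\<close> links
  \<open>C ** B\<close> with \<open>B ** C\<close>.\<close>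

lemma is_drazin_inv_intertwine:
  fixes T :: "complex^'m^'n"
  assumes X: "is_drazin_inv X G" and Y: "is_drazin_inv Y H" and XT: "X ** T = T ** Y"
  shows "G ** T = T ** H"
proof -
  define k where "k = mat_ind X + mat_ind Y"
  have GXk: "mat_pow X k ** (X ** G) = mat_pow X k" and HYk: "mat_pow Y k ** (Y ** H) = mat_pow Y k"
    using is_drazin_inv_pow[OF X] is_drazin_inv_pow[OF Y] unfolding k_def
    by (metis, metis add.commute)
  have XG: "X ** G = G ** X"
    using X by (simp add: is_drazin_inv_def)
  note XTk = mat_pow_intertwine[OF XT, of k]
  have "T ** (mat_pow Y k ** (Y ** H)) = T ** mat_pow Y k ** Y ** H"
    by (simp add: matrix_mul_assoc)
  also have "\<dots> = mat_pow X k ** (T ** Y) ** H"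
    by (simp add: XTk[symmetric] matrix_mul_assoc)
  also have "\<dots> = mat_pow X k ** X ** T ** H"
    by (simp add: XT[symmetric] matrix_mul_assoc)
  finally have "mat_pow X k ** T = mat_pow X k ** X ** T ** H"
    by (simp only: XTk HYk)
  then have "mat_pow G (Suc k) ** mat_pow X k ** T = mat_pow G (Suc k) ** mat_pow X k ** X ** T ** H"
    by (metis matrix_mul_assoc)
  then have 1: "G ** T = G ** X ** T ** H"
    by (simp only: is_drazin_inv_absorb(1)[OF X])
  have "X ** (X ** G) = (X ** G) ** X"
    by (simp add: XG matrix_mul_assoc)
  from mat_pow_intertwine[OF this, of k] have "mat_pow X k = G ** X ** mat_pow X k"
    using GXk XG by simp
  then have "T ** mat_pow Y k = G ** X ** (T ** mat_pow Y k)"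
    by (metis XTk matrix_mul_assoc)
  then have "T ** (mat_pow Y k ** mat_pow H (Suc k)) = G ** X ** (T ** (mat_pow Y k ** mat_pow H (Suc k)))"
    by (metis matrix_mul_assoc)
  then have "T ** H = G ** X ** (T ** H)"
    by (simp only: is_drazin_inv_absorb(2)[OF Y])
  with 1 show ?thesis by (simp add: matrix_mul_assoc)
qed

lemma is_drazin_inv_unique:
  assumes "is_drazin_inv X G" "is_drazin_inv X H"
  shows "G = H"
  using is_drazin_inv_intertwine[OF assms, of "mat 1"] by simp

text \<open>Rank stabilization for \<open>X\<close> and for \<open>transpose X\<close> yields a left
  factor \<open>V\<close> and a right factor \<open>W\<close> for one common power of
  \<open>X\<close>. Such two-sided divisibility (strong pi-regularity) produces the Drazin
  inverse.\<close>

lemma is_drazin_inv_exists: "\<exists>Y. is_drazin_inv X Y"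
proof -
  define j where "j = mat_ind (transpose X)"
  define k where "k = mat_ind X + j"
  obtain V where V0: "mat_pow X (mat_ind X) = V ** mat_pow X (Suc (mat_ind X))"
    by (rule mat_ind_left_factor)
  obtain U where "mat_pow (transpose X) j = U ** mat_pow (transpose X) (Suc j)"
    using mat_ind_left_factor j_def by metis
  then have W0: "mat_pow X j = mat_pow X (Suc j) ** transpose U"
    by (metis mat_pow_transpose matrix_transpose_mul transpose_transpose)
  define W where "W = transpose U"
  have V: "mat_pow X k = V ** mat_pow X (Suc k)"
    using V0 unfolding k_def by (metis add_Suc mat_pow_add matrix_mul_assoc)
  have W: "mat_pow X k = mat_pow X (Suc k) ** W"
    using W0 unfolding k_def W_def by (metis add_Suc_right mat_pow_add matrix_mul_assoc)
  have Vi: "mat_pow X k = mat_pow V i ** mat_pow X (k + i)" for i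
    using left_factor_iterate[OF V] .
  have Wi: "mat_pow X k = mat_pow X (k + i) ** mat_pow W i" for i
  proof (induction i)
    case (Suc i)
    have "mat_pow X (i + k) = mat_pow X (i + Suc k) ** W"
      using W by (metis mat_pow_add matrix_mul_assoc)
    then have "mat_pow X (k + i) = mat_pow X (k + Suc i) ** W"
      by (simp add: add.commute)
    then show ?case using Suc by (metis mat_pow.simps(2) matrix_mul_assoc)
  qed simp
  \<comment> \<open>\<open>e\<close> is the future idempotent \<open>X ** Y\<close>. Both
    \<open>e\<close> and \<open>Y\<close> have one form through \<open>W\<close> and one through
    \<open>V\<close>; the first computes \<open>X ** Y\<close>, the second
    \<open>Y ** X\<close>.\<close>
  define e where "e = mat_pow X k ** mat_pow W k"
  have e: "e = mat_pow V k ** mat_pow X k"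
    unfolding e_def by (metis Vi Wi mat_pow_add matrix_mul_assoc)
  define Y where "Y = mat_pow X k ** mat_pow W (Suc k)"
  have Y: "Y = mat_pow V (Suc k) ** mat_pow X k"
  proof -
    have "Y = mat_pow V (Suc k) ** mat_pow X (k + Suc k) ** mat_pow W (Suc k)"
      unfolding Y_def using Vi by metis
    also have "\<dots> = mat_pow V (Suc k) ** (mat_pow X (k + Suc k) ** mat_pow W (Suc k))"
      by (simp only: matrix_mul_assoc)
    finally show ?thesis using Wi by metis
  qed
  have "X ** Y = mat_pow X (Suc k) ** W ** mat_pow W k"
    by (simp add: Y_def matrix_mul_assoc)
  then have XY: "X ** Y = e"
    by (simp only: W[symmetric] e_def)
  have "Y ** X = mat_pow V k ** V ** mat_pow X (Suc k)"
    by (simp only: Y mat_pow_Suc_right matrix_mul_assoc)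
  then have YX: "Y ** X = e"
    using V e by (metis matrix_mul_assoc)
  have "e ** mat_pow X k = mat_pow X k"
    using e Vi by (metis mat_pow_add matrix_mul_assoc)
  then have "e ** Y = Y"
    unfolding Y_def by (metis matrix_mul_assoc)
  moreover have "mat_pow X k = mat_pow X (Suc k) ** Y"
    by (metis XY Wi e_def mat_pow_Suc_right mat_pow_add matrix_mul_assoc)
  ultimately show ?thesis
    using is_drazin_invI XY YX by metis
qed

section \<open>Identities for \<open>X\<^sup>d\<close>, \<open>X\<^sup>e\<close> and
  \<open>X\<^sup>\<pi>\<close>\<close>

lemma drazin_inv_is: "is_drazin_inv X (X\<^sup>d)"
  unfolding drazin_inv_def
  by (rule theI') (use is_drazin_inv_exists is_drazin_inv_unique in blast)

lemma drazin_inv_eqI: "is_drazin_inv X Y \<Longrightarrow> X\<^sup>d = Y"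
  using drazin_inv_is is_drazin_inv_unique by blast

lemma drazin_inv_commute: "X ** X\<^sup>d = X\<^sup>d ** X"
  and drazin_inv_outer: "X\<^sup>d ** X ** X\<^sup>d = X\<^sup>d"
  using drazin_inv_is[of X] by (auto simp: is_drazin_inv_def)

lemma drazin_inv_pow: "mat_pow X (mat_ind X + k) ** (X ** X\<^sup>d) = mat_pow X (mat_ind X + k)"
  using is_drazin_inv_pow[OF drazin_inv_is] .

lemma drazin_pi_pow:
  assumes "mat_ind X \<le> k"
  shows "mat_pow X k ** X\<^sup>\<pi> = 0"
  using drazin_inv_pow[of X "k - mat_ind X"] assms
  by (simp add: drazin_pi_def drazin_e_def matrix_diff_ldistrib)

lemma drazin_inv_intertwine:
  fixes T :: "complex^'m^'n"
  shows "X ** T = T ** Y \<Longrightarrow> X\<^sup>d ** T = T ** Y\<^sup>d"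
  by (rule is_drazin_inv_intertwine[OF drazin_inv_is drazin_inv_is])

lemma drazin_inv_mul: "X\<^sup>d ** X = X\<^sup>e" "X ** X\<^sup>d = X\<^sup>e"
  by (simp_all add: drazin_e_def drazin_inv_commute)

lemma drazin_e_mul_inv: "X\<^sup>e ** X\<^sup>d = X\<^sup>d" "X\<^sup>d ** X\<^sup>e = X\<^sup>d"
proof -
  show "X\<^sup>e ** X\<^sup>d = X\<^sup>d"
    by (simp only: drazin_e_def drazin_inv_commute drazin_inv_outer)
  show "X\<^sup>d ** X\<^sup>e = X\<^sup>d"
    by (simp only: drazin_e_def matrix_mul_assoc drazin_inv_outer)
qed

lemma drazin_e_idem: "X\<^sup>e ** X\<^sup>e = X\<^sup>e"
  and drazin_e_commute: "X\<^sup>e ** X = X ** X\<^sup>e"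
proof -
  have "X\<^sup>e ** X\<^sup>e = X\<^sup>e ** X\<^sup>d ** X"
    by (simp add: matrix_assoc_right drazin_inv_mul)
  then show "X\<^sup>e ** X\<^sup>e = X\<^sup>e"
    by (simp add: drazin_e_mul_inv drazin_inv_mul)
  show "X\<^sup>e ** X = X ** X\<^sup>e"
    unfolding drazin_e_def by (simp add: drazin_inv_commute matrix_mul_assoc)
qed

lemma drazin_pi_idem: "X\<^sup>\<pi> ** X\<^sup>\<pi> = X\<^sup>\<pi>"
  and drazin_e_pi: "X\<^sup>e ** X\<^sup>\<pi> = 0" "X\<^sup>\<pi> ** X\<^sup>e = 0"
  and drazin_pi_commute: "X\<^sup>\<pi> ** X = X ** X\<^sup>\<pi>"
  by (simp_all add: drazin_pi_def matrix_distribs drazin_e_idem drazin_e_commute)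

lemma drazin_inv_pi: "X\<^sup>d ** X\<^sup>\<pi> = 0" "X\<^sup>\<pi> ** X\<^sup>d = 0"
  by (simp_all add: drazin_pi_def matrix_distribs drazin_e_mul_inv)

text \<open>Exponent \<open>0\<close> is excluded because there the left side is
  \<open>mat 1\<close> and the right side is \<open>X\<^sup>\<pi>\<close>.\<close>

lemma mat_pow_mul_drazin_pi:
  assumes "1 \<le> k"
  shows "mat_pow (X ** X\<^sup>\<pi>) k = mat_pow X k ** X\<^sup>\<pi>"
  using assms
proof (induction k rule: dec_induct)
  case (step k)
  have "mat_pow (X ** X\<^sup>\<pi>) (Suc k) = mat_pow X k ** (X\<^sup>\<pi> ** X) ** X\<^sup>\<pi>"
    by (simp only: mat_pow_Suc_right step.IH matrix_mul_assoc)
  also have "\<dots> = mat_pow X k ** X ** X\<^sup>\<pi>"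
    by (simp add: drazin_pi_commute matrix_assoc_right drazin_pi_idem)
  finally show ?case
    by (simp only: mat_pow_Suc_right)
qed simp

text \<open>Squaring turns an off-diagonal block matrix into a block diagonal one. By intertwining,
  the Drazin inverse of the square commutes with \<open>X\<close>, and its power equation becomes
  one for \<open>X\<close> at a doubled exponent.\<close>

lemma drazin_inv_square: "X\<^sup>d = X ** (X ** X)\<^sup>d"
proof (rule drazin_inv_eqI)
  define W where "W = X ** X"
  have comm: "W\<^sup>d ** X = X ** W\<^sup>d"
    by (rule drazin_inv_intertwine) (simp add: W_def matrix_mul_assoc)
  have "is_drazin_inv X (X ** W\<^sup>d)"
  proof (rule is_drazin_invI)
    show "X ** (X ** W\<^sup>d) = X ** W\<^sup>d ** X"
      by (simp add: comm matrix_assoc_right)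
    have "X ** W\<^sup>d ** X ** (X ** W\<^sup>d) = X ** (W\<^sup>d ** W ** W\<^sup>d)"
      by (simp add: W_def matrix_assoc_right)
    then show "X ** W\<^sup>d ** X ** (X ** W\<^sup>d) = X ** W\<^sup>d"
      by (simp add: drazin_inv_outer)
    have pow: "mat_pow W k = mat_pow X (2 * k)" for k
      by (induction k) (simp_all add: W_def matrix_mul_assoc)
    have "mat_pow X (2 * mat_ind W) = mat_pow X (2 * mat_ind W) ** (W ** W\<^sup>d)"
      using drazin_inv_pow[of W 0] by (simp add: pow)
    also have "\<dots> = mat_pow X (Suc (2 * mat_ind W)) ** (X ** W\<^sup>d)"
      by (simp add: W_def mat_pow_Suc_right matrix_mul_assoc del: mat_pow.simps)
    finally show "mat_pow X (2 * mat_ind W) = mat_pow X (Suc (2 * mat_ind W)) ** (X ** W\<^sup>d)" .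
  qed
  then show "is_drazin_inv X (X ** (X ** X)\<^sup>d)"
    by (simp add: W_def)
qed

section \<open>Drazin inverses of sums\<close>

lemma mat_pow_add_annihilating:
  assumes "L ** K = 0"
  shows "mat_pow (K + L) j ** K = mat_pow K (Suc j)"
proof (induction j)
  case (Suc j)
  have "mat_pow (K + L) (Suc j) ** K = mat_pow (K + L) j ** ((K + L) ** K)"
    by (simp add: mat_pow_Suc_right matrix_assoc_right del: mat_pow.simps)
  also have "\<dots> = mat_pow (K + L) j ** K ** K"
    by (simp add: matrix_add_rdistrib assms matrix_mul_assoc)
  finally show ?case
    using Suc by (simp add: mat_pow_Suc_right del: mat_pow.simps)
qed simp

text \<open>
  The candidate for the Drazin inverse of a sum \<open>K + L\<close> is the Neumann series
  \<open>\<Sum>n. (K\<^sup>d)\<^sup>n\<^sup>+\<^sup>1 L\<^sup>n\<close>; all its properties come from the fixed-point equation for \<open>Y\<close>.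
\<close>

lemma drazin_inv_add_nilpotent_fixpoint:
  assumes LK: "L ** K = 0" and nil: "mat_pow L u = 0"
    and Y: "Y = K\<^sup>d + K\<^sup>d ** Y ** L"
  shows "(K + L)\<^sup>d = Y" and "(K + L)\<^sup>\<pi> = K\<^sup>\<pi> - Y ** L"
proof -
  let ?g = "K\<^sup>d" and ?G = "K + L"
  have gKg: "?g = K ** ?g ** ?g"
    using drazin_inv_commute[of K] drazin_inv_outer[of K] by simp
  have Lg: "L ** ?g = 0"
    by (subst gKg) (simp add: matrix_mul_assoc LK)
  have LY: "L ** Y = 0"
    by (subst Y) (simp add: matrix_add_ldistrib matrix_mul_assoc Lg)
  have YK: "Y ** K = K ** ?g"
    by (subst Y) (simp add: matrix_add_rdistrib matrix_assoc_right LK drazin_inv_commute)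
  have "K ** ?g ** Y = K ** ?g ** ?g + K ** ?g ** ?g ** Y ** L"
    by (subst Y) (simp add: matrix_add_ldistrib matrix_mul_assoc)
  then have KgY: "K ** ?g ** Y = Y"
    using Y gKg by simp
  have KY: "K ** Y = K ** ?g + Y ** L"
    by (subst Y) (simp add: matrix_add_ldistrib matrix_mul_assoc KgY)
  have GY: "?G ** Y = K ** ?g + Y ** L"
    by (simp add: matrix_add_rdistrib LY KY)
  have YG: "Y ** ?G = K ** ?g + Y ** L"
    by (simp add: matrix_add_ldistrib YK)
  have YGY: "Y ** ?G ** Y = Y"
    by (simp only: YG matrix_add_rdistrib KgY) (simp add: matrix_assoc_right LY)
  \<comment> \<open>\<open>p\<close> is \<open>mat 1 - ?G ** Y\<close>; the power equation asks that
    it annihilate some power of \<open>?G\<close>.\<close>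
  define p where "p = mat 1 - K ** ?g - Y ** L"
  define k where "k = mat_ind K"
  have pK: "p ** mat_pow K (Suc (k + m)) = 0" for m
  proof -
    have 1: "K ** ?g ** mat_pow K (Suc (k + m)) = mat_pow K (Suc (k + m))"
    proof -
      have "K ** (K ** ?g) = (K ** ?g) ** K"
        by (simp add: drazin_inv_commute matrix_mul_assoc)
      from mat_pow_intertwine[OF this, of "Suc (k + m)"] drazin_inv_pow[of K "Suc m"]
      show ?thesis by (simp add: k_def)
    qed
    have "L ** mat_pow K (Suc (k + m)) = 0"
      by (simp add: matrix_mul_assoc LK)
    with 1 show ?thesis
      by (simp add: p_def matrix_diff_rdistrib matrix_assoc_right del: mat_pow.simps)
  qed
  \<comment> \<open>A power of \<open>?G\<close> followed by \<open>K\<close> collapses to a power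
    of \<open>K\<close>, which \<open>p\<close> kills. Hence every further factor
    \<open>K + L\<close> may be replaced by \<open>L\<close>, until nilpotency applies.\<close>
  have "p ** mat_pow ?G (Suc (k + m)) = p ** mat_pow ?G (Suc k) ** mat_pow L m" for m
  proof (induction m)
    case (Suc m)
    have "p ** (mat_pow ?G (Suc (k + m)) ** K) = 0"
      using pK[of "Suc m"] by (simp only: mat_pow_add_annihilating[OF LK] add_Suc_right)
    moreover have "mat_pow ?G (Suc (k + Suc m)) = mat_pow ?G (Suc (k + m)) ** (K + L)"
      by (simp only: mat_pow_Suc_right[of ?G "Suc (k + m)"] add_Suc_right)
    ultimately have "p ** mat_pow ?G (Suc (k + Suc m)) = p ** mat_pow ?G (Suc (k + m)) ** L"
      by (simp only: matrix_add_ldistrib matrix_mul_assoc add_0_left)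
    then show ?case
      by (simp only: Suc mat_pow_Suc_right[of L m] matrix_mul_assoc)
  qed simp
  from this[of u] have "p ** mat_pow ?G (Suc (k + u)) = 0"
    by (simp only: nil times0_right)
  moreover have "p = mat 1 - ?G ** Y"
    by (simp add: p_def GY)
  ultimately have "?G ** Y ** mat_pow ?G (Suc (k + u)) = mat_pow ?G (Suc (k + u))"
    by (simp add: matrix_diff_rdistrib del: mat_pow.simps)
  moreover have "?G ** (?G ** Y) = (?G ** Y) ** ?G"
    by (metis GY YG matrix_mul_assoc)
  note mat_pow_intertwine[OF this, of "Suc (k + u)"]
  ultimately have "mat_pow ?G (Suc (k + u)) = mat_pow ?G (Suc (Suc (k + u))) ** Y"
    by (simp only: mat_pow_Suc_right[of ?G "Suc (k + u)"]) (simp only: matrix_assoc_right)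
  then have "is_drazin_inv ?G Y"
    using is_drazin_invI GY YG YGY by metis
  then show *: "?G\<^sup>d = Y"
    by (rule drazin_inv_eqI)
  show "?G\<^sup>\<pi> = K\<^sup>\<pi> - Y ** L"
    by (simp add: drazin_pi_def drazin_e_def * GY)
qed

text \<open>The truncated series solves the fixed-point equation exactly: multiplying by
  \<open>K\<^sup>d\<close> on the left and \<open>L\<close> on the right shifts each term to the
  next, and the term pushed past the end contains \<open>mat_pow L (Suc u) = 0\<close>.\<close>

lemma drazin_inv_add_nilpotent:
  assumes LK: "L ** K = 0" and nil: "mat_pow L (Suc u) = 0"
  shows "(K + L)\<^sup>d = K\<^sup>d + (\<Sum>k = 1..<Suc u. mat_pow (K\<^sup>d) (k + 1) ** mat_pow L k)"
    and "(K + L)\<^sup>\<pi> = K\<^sup>\<pi> - (\<Sum>k = 1..<Suc u. mat_pow (K\<^sup>d) k ** mat_pow L k)"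
proof -
  define f where "f k = mat_pow (K\<^sup>d) (Suc k) ** mat_pow L k" for k
  define Y where "Y = (\<Sum>k<Suc u. f k)"
  have split: "{..<Suc u} = insert 0 {1..<Suc u}"
    by auto
  have Y': "Y = K\<^sup>d + (\<Sum>k = 1..<Suc u. f k)"
    unfolding Y_def split by (simp add: f_def)
  have step: "K\<^sup>d ** f k ** L = f (Suc k)" for k
    by (simp add: f_def mat_pow_commute matrix_mul_assoc)
  have shift: "(\<Sum>k<Suc u. g (Suc k)) = (\<Sum>k = 1..<Suc u. g k) + g (Suc u)"
    for g :: "nat \<Rightarrow> complex^'a^'a"
    by (induction u) (simp_all add: algebra_simps)
  have "K\<^sup>d ** Y ** L = (\<Sum>k<Suc u. f (Suc k))"
    by (simp only: Y_def matrix_sum_left matrix_sum_right step)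
  also have "\<dots> = (\<Sum>k = 1..<Suc u. f k)"
    unfolding shift using nil by (simp add: f_def del: mat_pow.simps)
  finally have "Y = K\<^sup>d + K\<^sup>d ** Y ** L"
    using Y' by simp
  note series = drazin_inv_add_nilpotent_fixpoint[OF LK nil this]
  show "(K + L)\<^sup>d = K\<^sup>d + (\<Sum>k = 1..<Suc u. mat_pow (K\<^sup>d) (k + 1) ** mat_pow L k)"
    using series(1) Y' by (simp add: f_def)
  define g where "g k = mat_pow (K\<^sup>d) k ** mat_pow L k" for k
  have "f k ** L = g (Suc k)" for k
    by (simp add: f_def g_def mat_pow_commute matrix_mul_assoc)
  then have "Y ** L = (\<Sum>k<Suc u. g (Suc k))"
    by (simp only: Y_def matrix_sum_left)
  also have "\<dots> = (\<Sum>k = 1..<Suc u. g k)"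
    unfolding shift using nil by (simp add: g_def del: mat_pow.simps)
  finally show "(K + L)\<^sup>\<pi> = K\<^sup>\<pi> - (\<Sum>k = 1..<Suc u. mat_pow (K\<^sup>d) k ** mat_pow L k)"
    using series(2) by (simp add: g_def)
qed

text \<open>Relative to the idempotent \<open>E\<close>, \<open>P\<close> is an invertible corner,
  \<open>G\<close> the complementary corner, and \<open>N\<close> maps the range of \<open>E\<close>
  into the complement, so the sum is block triangular. Its Drazin inverse is
  \<open>Q + X + G\<^sup>d\<close>, where the off-diagonal entry solves the Sylvester equation
  \<open>X ** P - G ** X = N ** Q - G\<^sup>d ** N\<close>.\<close>

lemma drazin_inv_triangular:
  assumes PQ: "P ** Q = E" and QP: "Q ** P = E" and EQ: "E ** Q = Q" and QE: "Q ** E = Q"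
    and EP: "E ** P = P" and PE: "P ** E = P"
    and NE: "N ** E = N" and EN: "E ** N = 0" and EG: "E ** G = 0" and GE: "G ** E = 0"
  defines "r \<equiv> mat_ind G"
  shows "(P + N + G)\<^sup>d =
    G\<^sup>\<pi> ** (\<Sum>i<r. mat_pow G i ** (mat 1 + N ** Q) ** mat_pow Q (i + 1))
    + G\<^sup>d ** (mat 1 - E - N ** Q)"
proof -
  let ?H = "G\<^sup>d" and ?M = "P + N + G"
  \<comment> \<open>\<open>T\<close> is a truncated Neumann series for
    \<open>T ** P - G ** T = N ** Q\<close>. The equation holds up to a term with
    \<open>mat_pow G r\<close> on the left, which \<open>G\<^sup>\<pi>\<close> annihilates; the
    summand \<open>- ?H ** N ** Q\<close> of \<open>X\<close> covers the core part of
    \<open>G\<close>.\<close>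
  define T where "T = (\<Sum>i<r. mat_pow G i ** N ** mat_pow Q (i + 2))"
  define X where "X = G\<^sup>\<pi> ** T - ?H ** N ** Q"
  have HG: "?H ** G = G ** ?H"
    by (simp add: drazin_inv_commute)
  have GHH: "?H = G ** ?H ** ?H"
    using drazin_inv_outer[of G] by (simp add: HG)
  have HHG: "?H = ?H ** ?H ** G"
    using drazin_inv_outer[of G] by (simp add: HG[symmetric] matrix_assoc_right)
  have EH: "E ** ?H = 0"
    by (subst GHH) (simp add: matrix_mul_assoc EG)
  have HE: "?H ** E = 0"
    by (subst HHG) (simp add: matrix_assoc_right GE)
  have PN: "P ** N = 0" and QN: "Q ** N = 0" and PG: "P ** G = 0" and QG: "Q ** G = 0"
      and PH: "P ** ?H = 0"
    using PE QE EN EG EH by (metis matrix_mul_assoc times0_right)+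
  have NN: "N ** N = 0" and NG: "N ** G = 0" and NH: "N ** ?H = 0"
    using NE EN EG EH by (metis matrix_mul_assoc times0_right)+
  have GP: "G ** P = 0" and GQ: "G ** Q = 0" and HP: "?H ** P = 0" and HQ: "?H ** Q = 0"
    using EP EQ GE HE by (metis matrix_mul_assoc times0_left)+
  have Epi: "E ** G\<^sup>\<pi> = E" and Qpi: "G\<^sup>\<pi> ** Q = Q"
    by (simp_all add: drazin_pi_def drazin_e_def matrix_distribs matrix_mul_assoc EG)
      (simp add: matrix_assoc_right HQ)
  have pieces: "mat_pow G i ** N ** mat_pow Q (i + 2) ** E = mat_pow G i ** N ** mat_pow Q (i + 2)"
      "E ** (mat_pow G i ** N ** mat_pow Q (i + 2)) = 0"
      "mat_pow G i ** N ** mat_pow Q (i + 2) ** P = mat_pow G i ** N ** mat_pow Q (i + 1)" for i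
  proof -
    have Q2: "mat_pow Q (i + 2) = mat_pow Q (i + 1) ** Q" "mat_pow Q (i + 1) = mat_pow Q i ** Q"
      by (simp_all add: mat_pow_Suc_right del: mat_pow.simps)
    show "mat_pow G i ** N ** mat_pow Q (i + 2) ** E = mat_pow G i ** N ** mat_pow Q (i + 2)"
      by (simp only: Q2 matrix_assoc_right QE)
    have "E ** mat_pow G i ** N = 0"
      by (cases i) (simp_all add: EN EG matrix_mul_assoc)
    then show "E ** (mat_pow G i ** N ** mat_pow Q (i + 2)) = 0"
      by (metis matrix_mul_assoc times0_left)
    show "mat_pow G i ** N ** mat_pow Q (i + 2) ** P = mat_pow G i ** N ** mat_pow Q (i + 1)"
      by (simp only: Q2 matrix_assoc_right QP QE)
  qed
  have TE: "T ** E = T" and ET: "E ** T = 0"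
    unfolding T_def matrix_sum_left matrix_sum_right pieces by simp_all
  have XE: "X ** E = X"
    by (simp add: X_def matrix_diff_rdistrib matrix_assoc_right TE QE)
  have EX: "E ** X = 0"
    by (simp add: X_def matrix_diff_ldistrib matrix_mul_assoc Epi ET EH)
  have PX: "P ** X = 0" and NX: "N ** X = 0"
    using PE NE EX by (metis matrix_mul_assoc times0_right)+
  have XN: "X ** N = 0" and XG: "X ** G = 0"
    using XE EN EG by (metis matrix_mul_assoc times0_right)+
  have "T ** P - G ** T = (\<Sum>i<r. mat_pow G i ** N ** mat_pow Q (i + 1)
      - mat_pow G (Suc i) ** N ** mat_pow Q (Suc i + 1))"
    unfolding T_def matrix_sum_left matrix_sum_right pieces sum_subtractf
    by (simp add: matrix_mul_assoc)
  also have "\<dots> = N ** Q - mat_pow G r ** N ** mat_pow Q (r + 1)"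
    by (subst sum_lessThan_telescope') simp
  finally have TP: "T ** P = G ** T + N ** Q - mat_pow G r ** N ** mat_pow Q (r + 1)"
    by (simp add: algebra_simps)
  have pipow: "G\<^sup>\<pi> ** mat_pow G r = 0"
    using drazin_pi_pow[of G r] mat_pow_intertwine[of G "G\<^sup>\<pi>" G r] drazin_pi_commute[of G]
    by (simp add: r_def)
  have "X ** P = G\<^sup>\<pi> ** (G ** T) + G\<^sup>\<pi> ** (N ** Q) - ?H ** N"
    by (simp add: X_def matrix_distribs matrix_assoc_right TP QP NE
        pipow[THEN matrix_mul_tail] del: mat_pow.simps)
  also have "\<dots> = G ** X + N ** Q - ?H ** N"
    by (simp add: X_def matrix_distribs drazin_pi_commute matrix_mul_assoc)
      (simp add: drazin_pi_def drazin_e_def matrix_distribs)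
  finally have XP: "X ** P = G ** X + N ** Q - ?H ** N" .
  define Y where "Y = Q + X + ?H"
  have MY: "?M ** Y = E + N ** Q + G ** X + G ** ?H"
    by (simp add: Y_def matrix_distribs PQ PX PH NX NH GQ)
  have YM: "Y ** ?M = E + N ** Q + G ** X + G ** ?H"
    by (simp add: Y_def matrix_distribs QP QN QG XP XN XG HP HG)
  have HGX: "?H ** G ** X = - (?H ** N ** Q)"
    by (simp add: X_def matrix_distribs matrix_mul_assoc drazin_inv_outer)
      (simp add: matrix_assoc_right drazin_pi_commute[symmetric] drazin_inv_pi[THEN matrix_mul_tail])
  have "Y ** ?M ** Y = Y"
  proof -
    have "Y ** (?M ** Y) = Q + X + ?H ** N ** Q + ?H ** G ** X + ?H ** G ** ?H"
      unfolding MY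
      by (simp add: Y_def matrix_distribs matrix_mul_assoc QE XE HE QN XN QG XG)
    then show ?thesis
      by (simp add: HGX drazin_inv_outer Y_def matrix_mul_assoc)
  qed
  \<comment> \<open>One of the \<open>r + 2\<close> factors turns \<open>mat 1 - ?M ** Y\<close>
    into \<open>G ** ?p\<close>. The other \<open>r + 1\<close> collapse with this \<open>G\<close>
    to \<open>mat_pow G (Suc (Suc r))\<close>, which annihilates \<open>?p\<close>.\<close>
  moreover have "mat_pow ?M (Suc (Suc r)) = mat_pow ?M (Suc (Suc (Suc r))) ** Y"
  proof -
    let ?p = "G\<^sup>\<pi> - N ** Q - G ** X"
    have MG: "?M ** G = G ** G"
      by (simp add: matrix_distribs PG NG)
    have "?M ** (mat 1 - ?M ** Y) = G ** ?p"
      unfolding MY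
      by (simp add: matrix_distribs matrix_mul_assoc PE NE GE PN NN PG NG drazin_pi_def drazin_e_def)
    then have "mat_pow ?M (Suc (Suc r)) ** (mat 1 - ?M ** Y) = mat_pow ?M (Suc r) ** G ** ?p"
      by (simp add: mat_pow_Suc_right matrix_assoc_right del: mat_pow.simps)
    also have "mat_pow ?M (Suc r) ** G = mat_pow G (Suc (Suc r))"
      using mat_pow_add_annihilating[of "P + N" G "Suc r"]
      by (simp add: matrix_add_rdistrib PG NG add.commute del: mat_pow.simps)
    also have "mat_pow G (Suc (Suc r)) ** ?p = 0"
    proof -
      have pi: "mat_pow G (Suc (Suc r)) ** G\<^sup>\<pi> = 0" "mat_pow G (Suc r) ** G\<^sup>\<pi> = 0"
          "mat_pow G r ** G\<^sup>\<pi> = 0"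
        by (simp_all only: r_def drazin_pi_pow le_Suc_eq order_refl simp_thms)
      \<comment> \<open>The Sylvester equation yields two terms that cancel after multiplication by
        the power of \<open>G\<close>.\<close>
      have "N ** Q + G ** X = X ** P + ?H ** N"
        using XP by simp
      moreover have "mat_pow G (Suc (Suc r)) ** X = - (mat_pow G (Suc (Suc r)) ** ?H ** N ** Q)"
        using pi by (simp add: X_def matrix_distribs matrix_mul_assoc del: mat_pow.simps)
      then have "mat_pow G (Suc (Suc r)) ** (X ** P) = - (mat_pow G (Suc (Suc r)) ** ?H ** N)"
        by (simp add: matrix_mul_assoc matrix_minus_left del: mat_pow.simps)
          (simp add: matrix_assoc_right QP NE del: mat_pow.simps)
      ultimately have "mat_pow G (Suc (Suc r)) ** (N ** Q + G ** X) = 0"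
        by (simp add: matrix_add_ldistrib matrix_mul_assoc del: mat_pow.simps)
      then show ?thesis
        using pi by (simp add: matrix_add_ldistrib matrix_diff_ldistrib diff_diff_eq del: mat_pow.simps)
    qed
    finally show ?thesis
      by (simp add: matrix_diff_ldistrib mat_pow_Suc_right[of ?M "Suc (Suc r)"] matrix_mul_assoc
          del: mat_pow.simps)
  qed
  ultimately have "is_drazin_inv ?M Y"
    using is_drazin_invI MY YM by metis
  then have "?M\<^sup>d = Y"
    by (rule drazin_inv_eqI)
  moreover have "G\<^sup>\<pi> ** (\<Sum>i<r. mat_pow G i ** (mat 1 + N ** Q) ** mat_pow Q (i + 1))
      = Q + G\<^sup>\<pi> ** T"
  proof -
    have "(\<Sum>i<r. mat_pow G i ** (mat 1 + N ** Q) ** mat_pow Q (i + 1))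
        = (\<Sum>i<r. mat_pow G i ** mat_pow Q (i + 1)) + T"
      by (simp add: T_def matrix_distribs sum.distrib matrix_mul_assoc)
    moreover have "(\<Sum>i<r. mat_pow G i ** mat_pow Q (i + 1)) = Q"
    proof (cases r)
      case 0
      \<comment> \<open>With \<open>r = 0\<close> the sum is empty although it has to equal
        \<open>Q\<close>. In this case \<open>G\<close> is invertible, so \<open>E ** G = 0\<close>
        forces \<open>E = 0\<close> and thus \<open>Q = 0\<close>.\<close>
      then have "E = 0"
        using drazin_inv_pow[of G 0] EG unfolding r_def
        by (metis add_0_right mat_pow.simps(1) matrix_mul_assoc matrix_mul_lid matrix_mul_rid times0_left)
      then show ?thesis using EQ 0 by simp
    next
      case (Suc r')
      \<comment> \<open>Since \<open>G ** Q = 0\<close>, only the term \<open>i = 0\<close>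
        survives.\<close>
      have "mat_pow G i ** mat_pow Q (i + 1) = (if i = 0 then Q else 0)" for i
        by (cases i) (simp_all add: mat_pow_commute matrix_assoc_right GQ[THEN matrix_mul_tail])
      then show ?thesis using Suc by simp
    qed
    ultimately show ?thesis
      by (simp add: matrix_add_ldistrib Qpi)
  qed
  ultimately show ?thesis
    by (simp add: Y_def X_def matrix_distribs matrix_mul_assoc HE)
qed

section \<open>Block matrices\<close>

lemma block_mat_nth [simp]:
  "block_mat A C B D $ Inl i $ Inl j = A $ i $ j" "block_mat A C B D $ Inl i $ Inr k = C $ i $ k"
  "block_mat A C B D $ Inr l $ Inl j = B $ l $ j" "block_mat A C B D $ Inr l $ Inr k = D $ l $ k"
  by (simp_all add: block_mat_def)

lemma block_mat_eqI:
  assumes "\<And>i j. X $ Inl i $ Inl j = A $ i $ j" "\<And>i j. X $ Inl i $ Inr j = C $ i $ j"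
    "\<And>i j. X $ Inr i $ Inl j = B $ i $ j" "\<And>i j. X $ Inr i $ Inr j = D $ i $ j"
  shows "X = block_mat A C B D"
proof -
  have "X $ i $ j = block_mat A C B D $ i $ j" for i j
    by (cases i; cases j) (simp_all add: assms)
  then show ?thesis by (simp add: vec_eq_iff)
qed

lemma block_mat_inject:
  "block_mat A C B D = block_mat A' C' B' D' \<longleftrightarrow> A = A' \<and> C = C' \<and> B = B' \<and> D = D'"
proof
  assume "block_mat A C B D = block_mat A' C' B' D'"
  then have "block_mat A C B D $ i $ j = block_mat A' C' B' D' $ i $ j" for i j
    by simp
  from this[of "Inl _" "Inl _"] this[of "Inl _" "Inr _"] this[of "Inr _" "Inl _"]
    this[of "Inr _" "Inr _"]
  show "A = A' \<and> C = C' \<and> B = B' \<and> D = D'"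
    by (simp add: vec_eq_iff)
qed simp

lemma block_mat_cases:
  fixes X :: "complex^('n::finite + 'm::finite)^('p::finite + 'q::finite)"
  obtains A C B D where "X = block_mat A C B D"
  using that block_mat_eqI[of X "\<chi> i j. X $ Inl i $ Inl j" "\<chi> i j. X $ Inl i $ Inr j"
      "\<chi> i j. X $ Inr i $ Inl j" "\<chi> i j. X $ Inr i $ Inr j"]
  by simp

lemma block_mat_mul:
  "block_mat A C B D ** block_mat A' C' B' D'
    = block_mat (A ** A' + C ** B') (A ** C' + C ** D') (B ** A' + D ** B') (B ** C' + D ** D')"
  by (rule block_mat_eqI) (simp_all add: matrix_matrix_mult_def UNIV_Plus_UNIV[symmetric] sum.Plus
      del: UNIV_Plus_UNIV)

lemma block_mat_add:
  "block_mat A C B D + block_mat A' C' B' D' = block_mat (A + A') (C + C') (B + B') (D + D')"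
  by (rule block_mat_eqI) simp_all

lemma block_mat_diff:
  "block_mat A C B D - block_mat A' C' B' D' = block_mat (A - A') (C - C') (B - B') (D - D')"
  by (rule block_mat_eqI) simp_all

lemma block_mat_0: "block_mat 0 0 0 0 = 0"
  by (rule block_mat_eqI[symmetric]) simp_all

lemma block_mat_1: "block_mat (mat 1) 0 0 (mat 1) = mat 1"
  by (rule block_mat_eqI[symmetric]) (simp_all add: mat_def)

lemma mat_pow_block_diag:
  "mat_pow (block_mat A 0 0 D) k = block_mat (mat_pow A k) 0 0 (mat_pow D k)"
  by (induction k) (simp_all add: block_mat_1 block_mat_mul)

lemma drazin_inv_block_diag: "(block_mat A 0 0 D)\<^sup>d = block_mat A\<^sup>d 0 0 D\<^sup>d"
proof (rule drazin_inv_eqI, rule is_drazin_invI)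
  define k where "k = mat_ind A + mat_ind D"
  have "mat_pow A k ** (A ** A\<^sup>d) = mat_pow A k" "mat_pow D k ** (D ** D\<^sup>d) = mat_pow D k"
    using drazin_inv_pow unfolding k_def by (metis, metis add.commute)
  then have "mat_pow A k = mat_pow A (Suc k) ** A\<^sup>d" "mat_pow D k = mat_pow D (Suc k) ** D\<^sup>d"
    by (simp_all add: mat_pow_Suc_right matrix_mul_assoc del: mat_pow.simps)
  then show "mat_pow (block_mat A 0 0 D) k = mat_pow (block_mat A 0 0 D) (Suc k) ** block_mat A\<^sup>d 0 0 D\<^sup>d"
    unfolding mat_pow_block_diag block_mat_mul by (simp only: times0_left times0_right add_0_left add_0_right)
qed (simp_all add: block_mat_mul drazin_inv_commute[of A] drazin_inv_commute[of D] drazin_inv_outer)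

lemma drazin_pi_block_diag: "(block_mat A 0 0 D)\<^sup>\<pi> = block_mat A\<^sup>\<pi> 0 0 D\<^sup>\<pi>"
  by (simp add: drazin_pi_def drazin_e_def drazin_inv_block_diag block_mat_mul block_mat_diff
      flip: block_mat_1)

text \<open>The square is block diagonal with entries \<open>C ** B\<close> and
  \<open>B ** C\<close>. Intertwining through \<open>C\<close> leaves only
  \<open>(C ** B)\<^sup>d\<close>, and a matrix has the same \<open>\<pi>\<close>-projection as its
  square, which settles the second formula.\<close>

lemma drazin_block_antidiag:
  fixes C :: "complex^'m^'n" and B :: "complex^'n^'m"
  shows "(block_mat 0 C B 0)\<^sup>d = block_mat 0 ((C ** B)\<^sup>d ** C) (B ** (C ** B)\<^sup>d) 0"
    and "(block_mat 0 C B 0)\<^sup>\<pi> = block_mat (C ** B)\<^sup>\<pi> 0 0 (B ** C)\<^sup>\<pi>"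
proof -
  let ?K = "block_mat 0 C B 0"
  have sq: "?K ** ?K = block_mat (C ** B) 0 0 (B ** C)"
    by (simp add: block_mat_mul)
  have "(C ** B)\<^sup>d ** C = C ** (B ** C)\<^sup>d"
    by (rule drazin_inv_intertwine) (simp add: matrix_mul_assoc)
  then show d: "?K\<^sup>d = block_mat 0 ((C ** B)\<^sup>d ** C) (B ** (C ** B)\<^sup>d) 0"
    by (subst drazin_inv_square) (simp add: sq drazin_inv_block_diag block_mat_mul)
  have "?K ** ?K\<^sup>d = (?K ** ?K) ** (?K ** ?K)\<^sup>d"
    by (subst drazin_inv_square) (simp add: matrix_mul_assoc)
  then have "?K\<^sup>\<pi> = (?K ** ?K)\<^sup>\<pi>"
    by (simp add: drazin_pi_def drazin_e_def)
  then show "?K\<^sup>\<pi> = block_mat (C ** B)\<^sup>\<pi> 0 0 (B ** C)\<^sup>\<pi>"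
    by (simp add: sq drazin_pi_block_diag)
qed

section \<open>Inverses in a corner\<close>

text \<open>Inversion in the ring \<open>E ** _ ** E\<close> with unit \<open>E\<close>. It amounts
  to \<open>Y\<close> being the group inverse of \<open>X\<close> with \<open>X ** Y = E\<close>,
  stated as product rules fit for rewriting.\<close>

definition corner_inv :: "complex^'n^'n \<Rightarrow> complex^'n^'n \<Rightarrow> complex^'n^'n \<Rightarrow> bool" where
  "corner_inv E X Y \<longleftrightarrow>
     E ** E = E \<and> E ** X = X \<and> X ** E = X \<and> E ** Y = Y \<and> Y ** E = Y \<and> X ** Y = E \<and> Y ** X = E"

lemma corner_invD:
  assumes "corner_inv E X Y"
  shows "E ** E = E" "E ** X = X" "X ** E = X" "E ** Y = Y" "Y ** E = Y" "X ** Y = E" "Y ** X = E"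
  using assms by (simp_all add: corner_inv_def)

text \<open>A group inverse satisfies the Drazin equations with exponent \<open>1\<close>, so
  uniqueness is inherited.\<close>

lemma is_group_inv_unique:
  assumes "is_group_inv X Y" "is_group_inv X W"
  shows "Y = W"
proof -
  have "is_drazin_inv X V" if "is_group_inv X V" for V
    by (rule is_drazin_invI[where j = 1]) (use that in \<open>auto simp: is_group_inv_def matrix_assoc_right\<close>)
  then show ?thesis
    using assms is_drazin_inv_unique by blast
qed

lemma group_inv_is: "group_invertible X \<Longrightarrow> is_group_inv X (X\<^sup>#)"
  unfolding group_invertible_def group_inv_def
  by (rule theI') (use is_group_inv_unique in blast)

lemma group_inv_drazin:
  assumes "group_invertible X"
  shows "X\<^sup>d = X\<^sup>#"
  using group_inv_is[OF assms]
  by (intro drazin_inv_eqI is_drazin_invI[where j = 1]) (auto simp: is_group_inv_def matrix_assoc_right)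

lemma corner_inv_group_inv:
  assumes "corner_inv E X Y"
  shows "group_invertible X" "X\<^sup># = Y"
proof -
  have *: "is_group_inv X Y"
    using assms by (simp add: corner_inv_def is_group_inv_def)
  then show "group_invertible X"
    by (auto simp: group_invertible_def)
  from group_inv_is[OF this] * show "X\<^sup># = Y"
    by (rule is_group_inv_unique)
qed

lemma group_inv_corner:
  assumes "group_invertible X" "X ** X\<^sup># = E"
  shows "corner_inv E X (X\<^sup>#)"
  using group_inv_is[OF assms(1)] assms(2)
  unfolding corner_inv_def is_group_inv_def by (metis matrix_mul_assoc)

lemma corner_inv_of_drazin_e:
  assumes "group_invertible X" "X\<^sup>e = E"
  shows "corner_inv E X (X\<^sup>#)"
  using assms by (intro group_inv_corner) (simp_all add: drazin_e_def group_inv_drazin)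

text \<open>The core part of a matrix is a unit of its corner. For \<open>A\<close> and
  \<open>D\<close> this inverts the diagonal blocks of \<open>M\<^sub>E\<close>, as Schur
  complements require.\<close>

lemma drazin_corner_inv: "corner_inv X\<^sup>e (X ** X\<^sup>e) X\<^sup>d"
  by (simp add: corner_inv_def matrix_assoc_right drazin_e_idem drazin_e_mul_inv drazin_inv_mul
      drazin_e_commute[THEN matrix_mul_tail] drazin_inv_mul[THEN matrix_mul_tail])

text \<open>
  In the corner cut out by the idempotents \<open>E\<close> and \<open>F\<close> the block \<open>a\<close> has inverse \<open>a'\<close> and \<open>d\<close> has
  inverse \<open>d'\<close>; \<open>a - c d' b\<close> and \<open>d - b a' c\<close> are the two Schur complements.
\<close>

lemma schur_transfer:
  fixes b :: "complex^'n^'m" and c :: "complex^'m^'n"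
  assumes a: "corner_inv E a a'" and d: "corner_inv F d d'"
    and c: "E ** c = c" "c ** F = c" and b: "F ** b = b" "b ** E = b"
    and s: "corner_inv E (a - c ** d' ** b) \<sigma>"
  defines "\<zeta> \<equiv> d' + d' ** b ** \<sigma> ** c ** d'"
  shows "corner_inv F (d - b ** a' ** c) \<zeta>"
    and "a' ** c ** \<zeta> = \<sigma> ** c ** d'"
    and "\<zeta> ** b ** a' = d' ** b ** \<sigma>"
    and "\<sigma> = a' + a' ** c ** \<zeta> ** b ** a'"
    and "corner_inv (block_mat E 0 0 F) (block_mat a c b d)
          (block_mat \<sigma> (- (\<sigma> ** c ** d')) (- (d' ** b ** \<sigma>)) \<zeta>)"
proof -
  note A = corner_invD[OF a] and D = corner_invD[OF d] and S = corner_invD[OF s]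
  note tails = A[THEN matrix_mul_tail] D[THEN matrix_mul_tail] c[THEN matrix_mul_tail]
    b[THEN matrix_mul_tail] S(4,5)[THEN matrix_mul_tail]
  note eqs = A D c b S(4,5) tails
  have sl: "\<sigma> ** a = E + \<sigma> ** c ** d' ** b" and sr: "a ** \<sigma> = E + c ** d' ** b ** \<sigma>"
    using S(6,7) by (simp_all add: matrix_distribs matrix_mul_assoc algebra_simps)
  \<comment> \<open>Multiplication by \<open>a'\<close> gives resolvent identities:
    \<open>\<sigma> ** c ** d' ** b ** a'\<close> and its mirror image both equal
    \<open>\<sigma> - a'\<close>. They reduce the Woodbury expression \<open>\<zeta>\<close> to the
    transfer relations.\<close>
  have "(\<sigma> ** a) ** a' = a' + \<sigma> ** c ** d' ** b ** a'"
    unfolding sl by (simp add: matrix_assoc_right matrix_distribs eqs)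
  moreover have "a' ** (a ** \<sigma>) = a' + a' ** c ** d' ** b ** \<sigma>"
    unfolding sr by (simp add: matrix_assoc_right matrix_distribs eqs)
  ultimately have sl': "\<sigma> ** c ** d' ** b ** a' = \<sigma> - a'" and sr': "a' ** c ** d' ** b ** \<sigma> = \<sigma> - a'"
    by (simp_all add: matrix_assoc_right eqs) (metis add_diff_cancel_left')+
  note sl'r = sl'[unfolded matrix_assoc_right] and sr'r = sr'[unfolded matrix_assoc_right]
  have ac: "a' ** c ** \<zeta> = \<sigma> ** c ** d'"
  proof -
    have "a' ** c ** \<zeta> = a' ** c ** d' + (a' ** c ** d' ** b ** \<sigma>) ** c ** d'"
      by (simp add: \<zeta>_def matrix_distribs matrix_mul_assoc)
    then show ?thesis
      unfolding sr' by (simp add: matrix_distribs)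
  qed
  have ba: "\<zeta> ** b ** a' = d' ** b ** \<sigma>"
  proof -
    have "\<zeta> ** b ** a' = d' ** b ** a' + d' ** b ** (\<sigma> ** c ** d' ** b ** a')"
      by (simp add: \<zeta>_def matrix_distribs matrix_mul_assoc)
    then show ?thesis
      unfolding sl' by (simp add: matrix_distribs)
  qed
  show "a' ** c ** \<zeta> = \<sigma> ** c ** d'" "\<zeta> ** b ** a' = d' ** b ** \<sigma>"
    by (fact ac ba)+
  have "a' ** c ** \<zeta> ** b ** a' = \<sigma> ** c ** d' ** b ** a'"
    by (simp only: ac)
  then show "\<sigma> = a' + a' ** c ** \<zeta> ** b ** a'"
    by (simp add: sl')
  have F\<zeta>: "F ** \<zeta> = \<zeta>" "\<zeta> ** F = \<zeta>"
    by (simp_all add: \<zeta>_def matrix_distribs matrix_assoc_right eqs)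
  have d\<zeta>: "d ** \<zeta> = F + b ** \<sigma> ** c ** d'" and \<zeta>d: "\<zeta> ** d = F + d' ** b ** \<sigma> ** c"
    by (simp_all add: \<zeta>_def matrix_distribs matrix_assoc_right eqs)
  have bac: "b ** a' ** c ** \<zeta> = b ** \<sigma> ** c ** d'"
    using ac by (simp only: matrix_assoc_right)
  have bac': "\<zeta> ** b ** a' ** c = d' ** b ** \<sigma> ** c"
    by (simp only: ba)
  show "corner_inv F (d - b ** a' ** c) \<zeta>"
    unfolding corner_inv_def
  proof (intro conjI)
    show "F ** (d - b ** a' ** c) = d - b ** a' ** c"
      by (simp add: matrix_diff_ldistrib matrix_mul_assoc D b)
    show "(d - b ** a' ** c) ** F = d - b ** a' ** c"
      by (simp add: matrix_diff_rdistrib matrix_assoc_right D c)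
    show "(d - b ** a' ** c) ** \<zeta> = F"
      by (simp add: matrix_diff_rdistrib d\<zeta> bac)
    show "\<zeta> ** (d - b ** a' ** c) = F"
      by (simp add: matrix_diff_ldistrib matrix_mul_assoc \<zeta>d bac')
  qed (fact D F\<zeta>)+
  show "corner_inv (block_mat E 0 0 F) (block_mat a c b d)
          (block_mat \<sigma> (- (\<sigma> ** c ** d')) (- (d' ** b ** \<sigma>)) \<zeta>)"
    unfolding corner_inv_def block_mat_mul block_mat_inject
    by (simp add: matrix_distribs F\<zeta> d\<zeta> \<zeta>d sl sr)
      (simp add: \<zeta>_def matrix_distribs matrix_mul_assoc sl sr, simp add: matrix_assoc_right matrix_distribs sl eqs)
qed

text \<open>The upper left block \<open>q1\<close> of \<open>Q\<close> is the witness: two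
  off-diagonal equations, multiplied by \<open>d'\<close>, express \<open>q2\<close> and
  \<open>q3\<close> through \<open>q1\<close>, and the two equations with value \<open>E\<close>
  become the required products.\<close>

lemma schur_of_block_inverse:
  fixes b :: "complex^'n^'m" and c :: "complex^'m^'n"
  assumes a: "corner_inv E a a'" and d: "corner_inv F d d'"
    and c: "E ** c = c" "c ** F = c" and b: "F ** b = b" "b ** E = b"
    and M: "corner_inv (block_mat E 0 0 F) (block_mat a c b d) Q"
  obtains \<sigma> where "corner_inv E (a - c ** d' ** b) \<sigma>"
proof -
  obtain q1 q2 q3 q4 where Q: "Q = block_mat q1 q2 q3 q4"
    by (rule block_mat_cases)
  note A = corner_invD[OF a] and D = corner_invD[OF d]
  note M' = corner_invD[OF M, unfolded Q block_mat_mul block_mat_inject, simplified]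
  have bq: "b ** q1 + d ** q3 = 0" and aq: "a ** q1 + c ** q3 = E"
    and q2: "q1 ** c + q2 ** d = 0" and qa: "q1 ** a + q2 ** b = E"
    and q1: "E ** q1 = q1" "q1 ** E = q1" and q23: "q2 ** F = q2" "F ** q3 = q3"
    using M' by auto
  have "d' ** b ** q1 + q3 = 0"
    using arg_cong[OF bq, of "\<lambda>X. d' ** X"]
    by (simp add: matrix_distribs matrix_mul_assoc D q23 del: add.commute)
  moreover have "q1 ** c ** d' + q2 = 0"
    using arg_cong[OF q2, of "\<lambda>X. X ** d'"]
    by (simp add: matrix_distribs matrix_assoc_right D q23)
  ultimately have "q3 = - (d' ** b ** q1)" "q2 = - (q1 ** c ** d')"
    by (simp_all add: eq_neg_iff_add_eq_0 add.commute)
  then have "corner_inv E (a - c ** d' ** b) q1"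
    using aq qa q1 unfolding corner_inv_def
    by (simp add: matrix_distribs A matrix_mul_assoc c)
      (simp add: matrix_assoc_right b)
  then show ?thesis by (rule that)
qed

section \<open>The Schur complement conditions\<close>

text \<open>The sum acts as the identity on the range of \<open>X\<^sup>\<pi>\<close> and as
  \<open>s\<close> on the range of \<open>X\<^sup>e\<close>, so compressing its inverse to the
  corner inverts \<open>s\<close>.\<close>

lemma corner_inv_of_invertible_pi_add:
  assumes s: "X\<^sup>e ** s = s" "s ** X\<^sup>e = s" and inv: "invertible (X\<^sup>\<pi> + s)"
  obtains \<sigma> where "corner_inv X\<^sup>e s \<sigma>"
proof -
  obtain T where T: "(X\<^sup>\<pi> + s) ** T = mat 1" "T ** (X\<^sup>\<pi> + s) = mat 1"
    using inv unfolding invertible_def by blast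
  have "s ** T = X\<^sup>e" "T ** s = X\<^sup>e"
    using arg_cong[OF T(1), of "\<lambda>V. X\<^sup>e ** V"] arg_cong[OF T(2), of "\<lambda>V. V ** X\<^sup>e"]
    by (simp_all add: matrix_mul_assoc matrix_add_ldistrib drazin_e_pi s)
      (simp_all add: matrix_assoc_right matrix_add_rdistrib drazin_e_pi s)
  then have "corner_inv X\<^sup>e s (X\<^sup>e ** T ** X\<^sup>e)"
    unfolding corner_inv_def using s
    by (simp add: matrix_mul_assoc drazin_e_idem)
      (simp add: matrix_assoc_right drazin_e_idem drazin_e_idem[THEN matrix_mul_tail])
  then show ?thesis by (rule that)
qed

text \<open>\<open>X\<^sup>d\<close> is a unit of the corner and can be stripped off. The identity
  \<open>s ** X\<^sup>e = s\<close> is recovered from that for \<open>X\<^sup>d ** s\<close> by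
  multiplying with \<open>X\<close>.\<close>

lemma corner_inv_cancel_left:
  assumes s: "X\<^sup>e ** s = s" and V: "corner_inv X\<^sup>e (X\<^sup>d ** s) V"
  shows "corner_inv X\<^sup>e s (V ** X\<^sup>d)"
proof -
  note V' = corner_invD[OF V]
  have "s ** V = X ** (X\<^sup>d ** s ** V)"
    by (simp add: matrix_mul_assoc drazin_inv_mul s)
  then have sV: "s ** V = X ** X\<^sup>e"
    by (simp add: V')
  have "s ** X\<^sup>e = X ** (X\<^sup>d ** s ** X\<^sup>e)"
    by (simp add: matrix_mul_assoc drazin_inv_mul s)
  then have "s ** X\<^sup>e = s"
    by (simp only: V') (simp add: matrix_mul_assoc drazin_inv_mul s)
  then show ?thesis
    using s V' sV unfolding corner_inv_def
    by (simp add: matrix_mul_assoc drazin_e_idem)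
      (simp add: matrix_assoc_right drazin_e_mul_inv drazin_inv_mul)
qed

text \<open>Next to \<open>s\<close> the factor \<open>X\<close> acts as its core part, a unit of
  the corner with inverse \<open>X\<^sup>d\<close>.\<close>

lemma corner_inv_cancel_right:
  assumes s: "s ** X\<^sup>e = s" and V: "corner_inv X\<^sup>e (s ** X) V"
  shows "corner_inv X\<^sup>e s (X ** V)"
proof -
  note V' = corner_invD[OF V]
  have "V ** s = V ** (s ** X) ** X\<^sup>d"
    by (simp add: matrix_assoc_right drazin_inv_mul s)
  then have Vs: "V ** s = X\<^sup>d"
    by (simp add: V' drazin_e_mul_inv)
  have "X\<^sup>e ** s = X\<^sup>e ** (s ** X) ** X\<^sup>d"
    by (simp add: matrix_assoc_right drazin_inv_mul s)
  then have "X\<^sup>e ** s = s"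
    by (simp only: V') (simp add: matrix_assoc_right drazin_inv_mul s)
  then show ?thesis
    using s V' Vs unfolding corner_inv_def
    by (simp add: matrix_mul_assoc drazin_e_commute)
      (simp add: matrix_assoc_right drazin_inv_mul)
qed

text \<open>\<open>X\<close> stands for \<open>A\<close> or \<open>D\<close>, so one argument serves
  both Schur complements.\<close>

lemma corner_inv_of_schur_condition:
  assumes s: "s = X\<^sup>e ** S ** X\<^sup>e"
    and cond: "group_invertible s \<and> s\<^sup>e = X\<^sup>e \<or> invertible (X\<^sup>\<pi> + s)
      \<or> invertible (mat 1 + X\<^sup>d ** (s - X)) \<or> invertible (mat 1 + X\<^sup>d ** (S - mat 1) ** X)"
  obtains \<sigma> where "corner_inv X\<^sup>e s \<sigma>"
proof -
  have es: "X\<^sup>e ** s = s"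
    by (simp add: s matrix_mul_assoc drazin_e_idem)
  have se: "s ** X\<^sup>e = s"
    by (simp add: s matrix_assoc_right drazin_e_idem)
  consider "group_invertible s" "s\<^sup>e = X\<^sup>e" | "invertible (X\<^sup>\<pi> + s)"
    | "invertible (mat 1 + X\<^sup>d ** (s - X))" | "invertible (mat 1 + X\<^sup>d ** (S - mat 1) ** X)"
    using cond by blast
  then show ?thesis
  proof cases
    case 1
    then show ?thesis using corner_inv_of_drazin_e that by blast
  next
    case 2
    then show ?thesis using corner_inv_of_invertible_pi_add[OF es se] that by blast
  next
    case 3
    have "mat 1 + X\<^sup>d ** (s - X) = X\<^sup>\<pi> + X\<^sup>d ** s"
      by (simp add: drazin_pi_def matrix_diff_ldistrib drazin_inv_mul)
    moreover have "X\<^sup>e ** (X\<^sup>d ** s) = X\<^sup>d ** s" "X\<^sup>d ** s ** X\<^sup>e = X\<^sup>d ** s"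
      by (simp_all add: drazin_e_mul_inv[THEN matrix_mul_tail] matrix_assoc_right se)
    ultimately obtain V where "corner_inv X\<^sup>e (X\<^sup>d ** s) V"
      using corner_inv_of_invertible_pi_add 3 by metis
    then show ?thesis using corner_inv_cancel_left es that by blast
  next
    case 4
    \<comment> \<open>\<open>?u\<close> is the corner part of \<open>X\<^sup>d ** S ** X\<close>,
      while \<open>?w\<close> maps the complement into the corner, so \<open>?w ** ?w = 0\<close>.
      Left multiplication by the unipotent \<open>mat 1 - ?w\<close> removes \<open>?w\<close> and
      leaves \<open>X\<^sup>\<pi> + ?u\<close>.\<close>
    let ?u = "X\<^sup>d ** (s ** X)" and ?w = "X\<^sup>d ** S ** X ** X\<^sup>\<pi>"
    have u: "?u = X\<^sup>d ** S ** X ** X\<^sup>e"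
      by (simp add: s matrix_mul_assoc drazin_e_mul_inv)
        (simp add: matrix_assoc_right drazin_e_commute)
    have ue: "?u ** X\<^sup>e = ?u" and eu: "X\<^sup>e ** ?u = ?u"
      unfolding u by (simp add: matrix_assoc_right drazin_e_idem)
        (simp add: matrix_mul_assoc drazin_e_mul_inv)
    have "mat 1 + X\<^sup>d ** (S - mat 1) ** X = X\<^sup>\<pi> + X\<^sup>d ** S ** X"
      by (simp add: drazin_pi_def matrix_distribs drazin_inv_mul)
    also have "X\<^sup>d ** S ** X = ?u + ?w"
      by (simp add: u drazin_pi_def matrix_diff_ldistrib)
    finally have U: "mat 1 + X\<^sup>d ** (S - mat 1) ** X = X\<^sup>\<pi> + (?u + ?w)" .
    have pw: "X\<^sup>\<pi> ** ?w = 0" and pu: "X\<^sup>\<pi> ** ?u = 0"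
      by (simp_all add: matrix_mul_assoc drazin_inv_pi)
    have wpi: "?w ** X\<^sup>\<pi> = ?w"
      by (simp add: matrix_assoc_right drazin_pi_idem)
    have ww: "?w ** ?w = 0" and wu: "?w ** ?u = 0"
      using wpi pw pu by (metis matrix_mul_assoc times0_right)+
    have "(mat 1 + ?w) ** (mat 1 - ?w) = mat 1" "(mat 1 - ?w) ** (mat 1 + ?w) = mat 1"
      by (simp_all add: matrix_add_ldistrib matrix_add_rdistrib matrix_diff_ldistrib matrix_diff_rdistrib ww)
    then have "invertible (mat 1 - ?w)"
      unfolding invertible_def by blast
    from invertible_mult[OF this 4] have "invertible ((mat 1 - ?w) ** (X\<^sup>\<pi> + (?u + ?w)))"
      by (simp only: U)
    also have "(mat 1 - ?w) ** (X\<^sup>\<pi> + (?u + ?w)) = X\<^sup>\<pi> + ?u"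
      by (simp add: matrix_add_ldistrib matrix_diff_rdistrib wpi ww wu)
    finally obtain V where "corner_inv X\<^sup>e ?u V"
      using corner_inv_of_invertible_pi_add[OF eu ue] by blast
    then have "corner_inv X\<^sup>e (s ** X) (V ** X\<^sup>d)"
      by (intro corner_inv_cancel_left) (simp_all add: matrix_mul_assoc es)
    then show ?thesis
      using corner_inv_cancel_right[OF se] that by blast
  qed
qed

text \<open>\<open>w\<close> will be the group inverse of the other Schur complement. In
  \<open>s\<^sup># ** s\<close> with the right factor expanded, \<open>s_eq\<close> rewrites the
  first term and \<open>w_eq\<close> the second; the mixed products cancel and leave
  \<open>A\<^sup>e\<close>.\<close>

lemma corner_inv_of_schur_equations:
  fixes B :: "complex^'n^'m" and C :: "complex^'m^'n"
  assumes s: "s = A\<^sup>e ** (A - C ** D\<^sup>d ** B) ** A\<^sup>e" and inv: "group_invertible s"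
    and s_eq: "s\<^sup># = A\<^sup>d ** C ** w ** B ** A\<^sup>d + A\<^sup>d" and w_eq: "A\<^sup>d ** C ** w = s\<^sup># ** C ** D\<^sup>d"
  shows "corner_inv A\<^sup>e s (s\<^sup>#)"
proof -
  note g = group_inv_is[OF inv, unfolded is_group_inv_def]
  have "s\<^sup># = s\<^sup># ** s\<^sup># ** s"
    using g by (metis matrix_mul_assoc)
  moreover have "s ** A\<^sup>e = s"
    by (simp add: s matrix_assoc_right drazin_e_idem)
  ultimately have se: "s\<^sup># ** A\<^sup>e = s\<^sup>#"
    by (metis matrix_mul_assoc)
  have "s\<^sup># ** s = s\<^sup># ** A\<^sup>e ** A ** A\<^sup>e - s\<^sup># ** A\<^sup>e ** C ** D\<^sup>d ** B ** A\<^sup>e"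
    by (subst (2) s) (simp add: matrix_distribs matrix_mul_assoc)
  also have "\<dots> = s\<^sup># ** A ** A\<^sup>e - A\<^sup>d ** C ** w ** B ** A\<^sup>e"
    by (simp only: se w_eq)
  also have "s\<^sup># ** A ** A\<^sup>e = A\<^sup>d ** C ** w ** B ** A\<^sup>e + A\<^sup>e"
    by (subst s_eq) (simp add: matrix_add_rdistrib matrix_assoc_right
        drazin_inv_mul drazin_inv_mul[THEN matrix_mul_tail] drazin_e_idem)
  finally have "s ** s\<^sup># = A\<^sup>e"
    using g by simp
  with inv show ?thesis by (rule group_inv_corner)
qed

section \<open>From the Schur complement conditions to the formula for
  \<open>M\<^sup>d\<close>\<close>

theorem theorem4p2:
  fixes A :: "complex^'n^'n" and B :: "complex^'n^'m"
    and C :: "complex^'m^'n" and D :: "complex^'m^'m"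
    and S s :: "complex^'n^'n" and Z z :: "complex^'m^'m"
    and M E M\<^sub>E P\<^sub>1 :: "complex^('n + 'm)^('n + 'm)"
    and t r :: nat
  assumes "S = A - C ** D\<^sup>d ** B"
    and "s = A\<^sup>e ** S ** A\<^sup>e"
    and "Z = D - B ** A\<^sup>d ** C"
    and "z = D\<^sup>e ** Z ** D\<^sup>e"
    and "M = block_mat A C B D"
    and "E = block_mat A\<^sup>e 0 0 D\<^sup>e"
    and "M\<^sub>E = E ** M ** E"
    and "P\<^sub>1 = M\<^sub>E"
    and "t = max (mat_ind A) (mat_ind D)"
    and "r = mat_ind (block_mat (A ** A\<^sup>\<pi>) (C ** D\<^sup>\<pi>) (B ** A\<^sup>\<pi>) (D ** D\<^sup>\<pi>))"
    and conditions:
      "(group_invertible M\<^sub>E \<and> M\<^sub>E\<^sup>e = E)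
     \<or> (group_invertible s \<and> s\<^sup>e = A\<^sup>e)
     \<or> (group_invertible z \<and> z\<^sup>e = D\<^sup>e)
     \<or> invertible (A\<^sup>\<pi> + s)
     \<or> (invertible (mat 1 + A\<^sup>d ** (s - A)) \<or> invertible (mat 1 + A\<^sup>d ** (S - mat 1) ** A))
     \<or> (invertible (mat 1 + A\<^sup>d ** (s - A))
          \<and> s\<^sup>d = matrix_inv (mat 1 + A\<^sup>d ** (s - A)) ** A\<^sup>d)
     \<or> invertible (D\<^sup>\<pi> + z)
     \<or> (invertible (mat 1 + D\<^sup>d ** (z - D)) \<or> invertible (mat 1 + D\<^sup>d ** (Z - mat 1) ** D))
     \<or> (invertible (mat 1 + D\<^sup>d ** (z - D))
          \<and> z\<^sup>d = matrix_inv (mat 1 + D\<^sup>d ** (z - D)) ** D\<^sup>d)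
     \<or> (group_invertible s \<and> group_invertible z
          \<and> s\<^sup># = A\<^sup>d ** C ** z\<^sup># ** B ** A\<^sup>d + A\<^sup>d
          \<and> A\<^sup>d ** C ** z\<^sup># = s\<^sup># ** C ** D\<^sup>d)
     \<or> (group_invertible s \<and> group_invertible z
          \<and> z\<^sup># = D\<^sup>d ** B ** s\<^sup># ** C ** D\<^sup>d + D\<^sup>d
          \<and> D\<^sup>d ** B ** s\<^sup># = z\<^sup># ** B ** A\<^sup>d)
     \<or> (group_invertible M\<^sub>E \<and> group_invertible s \<and> group_invertible z
          \<and> M\<^sub>E\<^sup># = block_mat (A\<^sup>d + A\<^sup>d ** C ** z\<^sup># ** B ** A\<^sup>d) (- (A\<^sup>d ** C ** z\<^sup>#))
                             (- (z\<^sup># ** B ** A\<^sup>d)) (z\<^sup>#)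
          \<and> M\<^sub>E\<^sup># = block_mat (s\<^sup>#) (- (s\<^sup># ** C ** D\<^sup>d))
                             (- (D\<^sup>d ** B ** s\<^sup>#)) (D\<^sup>d ** B ** s\<^sup># ** C ** D\<^sup>d + D\<^sup>d))"
    and "A ** C ** D\<^sup>\<pi> = 0"
    and "D ** B ** A\<^sup>\<pi> = 0"
  shows "group_invertible P\<^sub>1 \<and> group_invertible s \<and> group_invertible z
    \<and> P\<^sub>1\<^sup># = block_mat (A\<^sup>d + A\<^sup>d ** C ** z\<^sup># ** B ** A\<^sup>d) (- (A\<^sup>d ** C ** z\<^sup>#))
                       (- (z\<^sup># ** B ** A\<^sup>d)) (z\<^sup>#)
    \<and> P\<^sub>1\<^sup># = block_mat (s\<^sup>#) (- (s\<^sup># ** C ** D\<^sup>d))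
                       (- (D\<^sup>d ** B ** s\<^sup>#)) (D\<^sup>d ** B ** s\<^sup># ** C ** D\<^sup>d + D\<^sup>d)
    \<and> M\<^sup>d =
        (block_mat (C ** B ** A\<^sup>\<pi>)\<^sup>\<pi> 0 0 (B ** C ** D\<^sup>\<pi>)\<^sup>\<pi>
          - (\<Sum>k = 1..<t.
              mat_pow (block_mat 0 ((C ** B ** A\<^sup>\<pi>)\<^sup>d ** C ** D\<^sup>\<pi>)
                                 (B ** A\<^sup>\<pi> ** (C ** B ** A\<^sup>\<pi>)\<^sup>d) 0) k
              ** block_mat (mat_pow A k ** A\<^sup>\<pi>) 0 0 (mat_pow D k ** D\<^sup>\<pi>)))
        ** (\<Sum>i<r.
              mat_pow (block_mat (A ** A\<^sup>\<pi>) (C ** D\<^sup>\<pi>) (B ** A\<^sup>\<pi>) (D ** D\<^sup>\<pi>)) i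
              ** (mat 1 + block_mat 0 (A\<^sup>\<pi> ** C ** D\<^sup>e) (D\<^sup>\<pi> ** B ** A\<^sup>e) 0 ** P\<^sub>1\<^sup>#)
              ** mat_pow (P\<^sub>1\<^sup>#) (i + 1))
      + (block_mat 0 ((C ** B ** A\<^sup>\<pi>)\<^sup>d ** C ** D\<^sup>\<pi>)
                   (B ** A\<^sup>\<pi> ** (C ** B ** A\<^sup>\<pi>)\<^sup>d) 0
          + (\<Sum>k = 1..<t.
              mat_pow (block_mat 0 ((C ** B ** A\<^sup>\<pi>)\<^sup>d ** C ** D\<^sup>\<pi>)
                                 (B ** A\<^sup>\<pi> ** (C ** B ** A\<^sup>\<pi>)\<^sup>d) 0) (k + 1)
              ** block_mat (mat_pow A k ** A\<^sup>\<pi>) 0 0 (mat_pow D k ** D\<^sup>\<pi>)))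
        ** (block_mat A\<^sup>\<pi> 0 0 D\<^sup>\<pi>
              - block_mat 0 (A\<^sup>\<pi> ** C ** D\<^sup>e) (D\<^sup>\<pi> ** B ** A\<^sup>e) 0 ** P\<^sub>1\<^sup>#)"
proof -
  note S = assms(1) and s = assms(2) and Z = assms(3) and z = assms(4) and M = assms(5)
    and E = assms(6) and ME = assms(7) and P1 = assms(8) and t = assms(9) and r = assms(10)
    and AC = assms(12) and DB = assms(13)
  \<comment> \<open>These are the blocks of \<open>M\<^sub>E\<close>; \<open>s\<close> and
    \<open>z\<close> are its two Schur complements in the corners.\<close>
  define a c b d where "a = A ** A\<^sup>e" and "c = A\<^sup>e ** C ** D\<^sup>e" and "b = D\<^sup>e ** B ** A\<^sup>e"
    and "d = D ** D\<^sup>e"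
  note defs = a_def c_def b_def d_def
  have a: "corner_inv A\<^sup>e a A\<^sup>d" and d: "corner_inv D\<^sup>e d D\<^sup>d"
    unfolding defs by (rule drazin_corner_inv)+
  have c: "A\<^sup>e ** c = c" "c ** D\<^sup>e = c" and b: "D\<^sup>e ** b = b" "b ** A\<^sup>e = b"
    unfolding defs by (simp_all add: matrix_mul_assoc drazin_e_idem)
      (simp_all add: matrix_assoc_right drazin_e_idem)
  have s': "s = a - c ** D\<^sup>d ** b"
    by (simp add: s S defs matrix_distribs matrix_assoc_right drazin_e_mul_inv[THEN matrix_mul_tail]
        drazin_e_commute[THEN matrix_mul_tail] drazin_e_idem)
  have z': "z = d - b ** A\<^sup>d ** c"
    by (simp add: z Z defs matrix_distribs matrix_assoc_right drazin_e_mul_inv[THEN matrix_mul_tail]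
        drazin_e_commute[THEN matrix_mul_tail] drazin_e_idem)
  have ME': "M\<^sub>E = block_mat a c b d"
    by (simp add: ME E M defs block_mat_mul matrix_assoc_right
        drazin_e_commute[THEN matrix_mul_tail] drazin_e_idem)
  \<comment> \<open>The transfer with the diagonal blocks exchanged makes it enough to invert either
    Schur complement.\<close>
  have from_z: "\<exists>\<sigma>. corner_inv A\<^sup>e s \<sigma>" if "corner_inv D\<^sup>e z \<zeta>" for \<zeta>
    using schur_transfer(1)[OF d a b c] that by (auto simp: s' z')
  from conditions have "\<exists>\<sigma>. corner_inv A\<^sup>e s \<sigma>"
  proof (elim disjE conjE)
    assume "group_invertible M\<^sub>E" "M\<^sub>E\<^sup>e = E"
    from corner_inv_of_drazin_e[OF this] show ?thesis
      using schur_of_block_inverse[OF a d c b] by (metis E ME' s')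
  next
    assume "group_invertible s" "s\<^sup># = A\<^sup>d ** C ** z\<^sup># ** B ** A\<^sup>d + A\<^sup>d"
      "A\<^sup>d ** C ** z\<^sup># = s\<^sup># ** C ** D\<^sup>d"
    then show ?thesis
      using corner_inv_of_schur_equations[OF s[unfolded S]] by blast
  next
    assume "group_invertible z" "z\<^sup># = D\<^sup>d ** B ** s\<^sup># ** C ** D\<^sup>d + D\<^sup>d"
      "D\<^sup>d ** B ** s\<^sup># = z\<^sup># ** B ** A\<^sup>d"
    then show ?thesis
      using corner_inv_of_schur_equations[OF z[unfolded Z]] from_z by blast
  next
    assume inv: "group_invertible s"
      and "M\<^sub>E\<^sup># = block_mat (A\<^sup>d + A\<^sup>d ** C ** z\<^sup># ** B ** A\<^sup>d) (- (A\<^sup>d ** C ** z\<^sup>#))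
                           (- (z\<^sup># ** B ** A\<^sup>d)) (z\<^sup>#)" (is "_ = ?X")
        "M\<^sub>E\<^sup># = block_mat (s\<^sup>#) (- (s\<^sup># ** C ** D\<^sup>d))
                           (- (D\<^sup>d ** B ** s\<^sup>#)) (D\<^sup>d ** B ** s\<^sup># ** C ** D\<^sup>d + D\<^sup>d)" (is "_ = ?Y")
    \<comment> \<open>Comparing the blocks of the two forms recovers the pair of equations for
      \<open>s\<^sup>#\<close> and \<open>z\<^sup>#\<close> treated above.\<close>
    then have "?Y = ?X"
      by metis
    then have "s\<^sup># = A\<^sup>d ** C ** z\<^sup># ** B ** A\<^sup>d + A\<^sup>d" "A\<^sup>d ** C ** z\<^sup># = s\<^sup># ** C ** D\<^sup>d"
      unfolding block_mat_inject by (metis add.commute, metis neg_equal_iff_equal)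
    with inv show ?thesis
      using corner_inv_of_schur_equations[OF s[unfolded S]] by blast
  \<comment> \<open>The remaining conditions are alternatives of one lemma, for \<open>A\<close> or
    for \<open>D\<close>; those with \<open>matrix_inv\<close> contribute their invertibility
    conjunct.\<close>
  qed (use corner_inv_of_schur_condition[OF s] corner_inv_of_schur_condition[OF z] from_z in blast)+
  then obtain \<sigma> where \<sigma>: "corner_inv A\<^sup>e (a - c ** D\<^sup>d ** b) \<sigma>"
    by (auto simp: s')
  define \<zeta> where "\<zeta> = D\<^sup>d + D\<^sup>d ** b ** \<sigma> ** c ** D\<^sup>d"
  note transfer = schur_transfer[OF a d c b \<sigma>, folded \<zeta>_def]
  have s_inv: "group_invertible s" "s\<^sup># = \<sigma>"
    using corner_inv_group_inv \<sigma> by (simp_all add: s')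
  have z_inv: "group_invertible z" "z\<^sup># = \<zeta>"
    using corner_inv_group_inv transfer(1) by (simp_all add: z')
  define Q where "Q = block_mat \<sigma> (- (\<sigma> ** c ** D\<^sup>d)) (- (D\<^sup>d ** b ** \<sigma>)) \<zeta>"
  have Q: "corner_inv E P\<^sub>1 Q"
    using transfer(5) by (simp add: Q_def E P1 ME')
  note P_inv = corner_inv_group_inv[OF Q]
  note \<sigma>' = corner_invD[OF \<sigma>] and \<zeta>' = corner_invD[OF transfer(1)]
  \<comment> \<open>The idempotents inside \<open>c\<close> and \<open>b\<close> are absorbed by the
    neighbouring factors, which brings \<open>Q\<close> into both announced forms.\<close>
  have drop_e: "\<sigma> ** c ** D\<^sup>d = \<sigma> ** C ** D\<^sup>d" "D\<^sup>d ** b ** \<sigma> = D\<^sup>d ** B ** \<sigma>"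
    "A\<^sup>d ** c ** \<zeta> = A\<^sup>d ** C ** \<zeta>" "\<zeta> ** b ** A\<^sup>d = \<zeta> ** B ** A\<^sup>d"
    unfolding c_def b_def
    by (simp_all add: matrix_mul_assoc \<sigma>' \<zeta>' drazin_e_mul_inv)
      (simp_all add: matrix_assoc_right \<sigma>' \<zeta>' drazin_e_mul_inv)
  have Q1: "Q = block_mat \<sigma> (- (\<sigma> ** C ** D\<^sup>d)) (- (D\<^sup>d ** B ** \<sigma>)) (D\<^sup>d ** B ** \<sigma> ** C ** D\<^sup>d + D\<^sup>d)"
  proof -
    have "D\<^sup>d ** b ** \<sigma> ** c ** D\<^sup>d = D\<^sup>d ** B ** (\<sigma> ** c ** D\<^sup>d)"
      by (simp only: drop_e(2) matrix_mul_assoc)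
    then show ?thesis
      by (simp add: Q_def \<zeta>_def drop_e matrix_mul_assoc add.commute)
  qed
  have Q2: "Q = block_mat (A\<^sup>d + A\<^sup>d ** C ** \<zeta> ** B ** A\<^sup>d) (- (A\<^sup>d ** C ** \<zeta>)) (- (\<zeta> ** B ** A\<^sup>d)) \<zeta>"
  proof -
    have "A\<^sup>d ** c ** \<zeta> ** b ** A\<^sup>d = A\<^sup>d ** C ** (\<zeta> ** b ** A\<^sup>d)"
      by (simp only: drop_e(3) matrix_mul_assoc)
    then have "\<sigma> = A\<^sup>d + A\<^sup>d ** C ** \<zeta> ** B ** A\<^sup>d"
      using transfer(4) by (simp add: drop_e matrix_mul_assoc)
    moreover have "\<sigma> ** c ** D\<^sup>d = A\<^sup>d ** C ** \<zeta>" "D\<^sup>d ** b ** \<sigma> = \<zeta> ** B ** A\<^sup>d"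
      using transfer(2,3) drop_e by simp_all
    ultimately show ?thesis
      unfolding Q_def block_mat_inject by simp
  qed

  \<comment> \<open>With \<open>F = mat 1 - E\<close>, these are \<open>F ** M ** E\<close> and
    \<open>F ** M ** F\<close>. The hypotheses, multiplied by \<open>A\<^sup>d\<close> and
    \<open>D\<^sup>d\<close>, make \<open>E ** M ** F\<close> vanish and simplify the off-diagonal
    blocks of \<open>G\<close>.\<close>
  define N where "N = block_mat 0 (A\<^sup>\<pi> ** C ** D\<^sup>e) (D\<^sup>\<pi> ** B ** A\<^sup>e) 0"
  define G where "G = block_mat (A ** A\<^sup>\<pi>) (C ** D\<^sup>\<pi>) (B ** A\<^sup>\<pi>) (D ** D\<^sup>\<pi>)"
  have "A\<^sup>e ** C ** D\<^sup>\<pi> = A\<^sup>d ** (A ** C ** D\<^sup>\<pi>)" "D\<^sup>e ** B ** A\<^sup>\<pi> = D\<^sup>d ** (D ** B ** A\<^sup>\<pi>)"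
    by (simp_all add: matrix_mul_assoc drazin_inv_mul)
  then have eC: "A\<^sup>e ** C ** D\<^sup>\<pi> = 0" and eB: "D\<^sup>e ** B ** A\<^sup>\<pi> = 0"
    by (simp_all add: AC DB)
  then have piC: "A\<^sup>\<pi> ** C ** D\<^sup>\<pi> = C ** D\<^sup>\<pi>" and piB: "D\<^sup>\<pi> ** B ** A\<^sup>\<pi> = B ** A\<^sup>\<pi>"
    by (simp_all add: drazin_pi_def[of A] drazin_pi_def[of D] matrix_diff_rdistrib)
  have M': "M = P\<^sub>1 + N + G"
  proof -
    have "A = A ** A\<^sup>e + A ** A\<^sup>\<pi>" "D = D ** D\<^sup>e + D ** D\<^sup>\<pi>"
      by (simp_all add: drazin_pi_def matrix_diff_ldistrib)
    moreover have "C = A\<^sup>e ** C ** D\<^sup>e + A\<^sup>\<pi> ** C ** D\<^sup>e + C ** D\<^sup>\<pi>"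
      "B = D\<^sup>e ** B ** A\<^sup>e + D\<^sup>\<pi> ** B ** A\<^sup>e + B ** A\<^sup>\<pi>"
      by (simp_all add: drazin_pi_def matrix_diff_ldistrib matrix_diff_rdistrib)
    ultimately show ?thesis
      by (simp add: M P1 ME' N_def G_def block_mat_add block_mat_inject defs)
  qed
  have NE: "N ** E = N" and EN: "E ** N = 0" and EG: "E ** G = 0" and GE: "G ** E = 0"
    by (simp_all add: N_def G_def E block_mat_mul block_mat_inject eC eB matrix_mul_assoc
        drazin_e_pi drazin_e_commute flip: block_mat_0)
      (simp_all add: matrix_assoc_right drazin_e_idem drazin_e_pi)
  have pi_E: "block_mat A\<^sup>\<pi> 0 0 D\<^sup>\<pi> = mat 1 - E"
    by (simp add: E drazin_pi_def block_mat_diff flip: block_mat_1)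
  note Q' = corner_invD[OF Q]
  have Md: "M\<^sup>d = G\<^sup>\<pi> ** (\<Sum>i<r. mat_pow G i ** (mat 1 + N ** Q) ** mat_pow Q (i + 1))
      + G\<^sup>d ** (block_mat A\<^sup>\<pi> 0 0 D\<^sup>\<pi> - N ** Q)"
    unfolding M' pi_E r G_def[symmetric]
    by (rule drazin_inv_triangular[OF Q'(6,7,4,5,2,3) NE EN EG GE])

  define K where "K = block_mat 0 (C ** D\<^sup>\<pi>) (B ** A\<^sup>\<pi>) 0"
  define L where "L = block_mat (A ** A\<^sup>\<pi>) 0 0 (D ** D\<^sup>\<pi>)"
  define Kd where "Kd = block_mat 0 ((C ** B ** A\<^sup>\<pi>)\<^sup>d ** C ** D\<^sup>\<pi>)
    (B ** A\<^sup>\<pi> ** (C ** B ** A\<^sup>\<pi>)\<^sup>d) 0"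
  have KL: "G = K + L"
    by (simp add: G_def K_def L_def block_mat_add)
  have "A ** A\<^sup>\<pi> ** (C ** D\<^sup>\<pi>) = A ** (A\<^sup>\<pi> ** C ** D\<^sup>\<pi>)"
    "D ** D\<^sup>\<pi> ** (B ** A\<^sup>\<pi>) = D ** (D\<^sup>\<pi> ** B ** A\<^sup>\<pi>)"
    by (simp_all only: matrix_mul_assoc)
  then have LK: "L ** K = 0"
    by (simp add: L_def K_def block_mat_mul piC piB matrix_mul_assoc AC DB block_mat_0)
  \<comment> \<open>By \<open>piB\<close> and \<open>piC\<close> the inner projections disappear, so
    the diagonal blocks of \<open>K ** K\<close> are the products named in the formula.\<close>
  have "C ** D\<^sup>\<pi> ** (B ** A\<^sup>\<pi>) = C ** (D\<^sup>\<pi> ** B ** A\<^sup>\<pi>)"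
    "B ** A\<^sup>\<pi> ** (C ** D\<^sup>\<pi>) = B ** (A\<^sup>\<pi> ** C ** D\<^sup>\<pi>)"
    by (simp_all only: matrix_mul_assoc)
  then have CB: "C ** D\<^sup>\<pi> ** (B ** A\<^sup>\<pi>) = C ** B ** A\<^sup>\<pi>" and BC: "B ** A\<^sup>\<pi> ** (C ** D\<^sup>\<pi>) = B ** C ** D\<^sup>\<pi>"
    by (simp_all only: piC piB matrix_mul_assoc)
  have Kd: "K\<^sup>d = Kd" and Kpi: "K\<^sup>\<pi> = block_mat (C ** B ** A\<^sup>\<pi>)\<^sup>\<pi> 0 0 (B ** C ** D\<^sup>\<pi>)\<^sup>\<pi>"
    unfolding K_def Kd_def drazin_block_antidiag CB BC by (simp_all only: matrix_mul_assoc)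
  have L_pow: "mat_pow L k = block_mat (mat_pow A k ** A\<^sup>\<pi>) 0 0 (mat_pow D k ** D\<^sup>\<pi>)" if "1 \<le> k" for k
    by (simp add: L_def mat_pow_block_diag mat_pow_mul_drazin_pi[OF that])
  \<comment> \<open>For \<open>t = 0\<close> truncated subtraction makes this exponent
    \<open>1\<close>. It is always positive, as \<open>L_pow\<close> requires, and at least
    \<open>t\<close>, so both diagonal blocks vanish.\<close>
  have "mat_pow L (Suc (t - 1)) = 0"
    by (subst L_pow) (simp_all add: drazin_pi_pow t block_mat_0 del: mat_pow.simps)
  note add = drazin_inv_add_nilpotent[OF LK this, folded KL, unfolded Kd Kpi]
  have interval: "{1..<Suc (t - 1)} = {1..<t}"
    by auto
  have Gd: "G\<^sup>d = Kd + (\<Sum>k = 1..<t. mat_pow Kd (k + 1) **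
      block_mat (mat_pow A k ** A\<^sup>\<pi>) 0 0 (mat_pow D k ** D\<^sup>\<pi>))"
    unfolding add(1) interval by (intro arg_cong2[of _ _ _ _ "(+)"] sum.cong refl) (simp add: L_pow)
  have Gpi: "G\<^sup>\<pi> = block_mat (C ** B ** A\<^sup>\<pi>)\<^sup>\<pi> 0 0 (B ** C ** D\<^sup>\<pi>)\<^sup>\<pi> - (\<Sum>k = 1..<t. mat_pow Kd k **
      block_mat (mat_pow A k ** A\<^sup>\<pi>) 0 0 (mat_pow D k ** D\<^sup>\<pi>))"
    unfolding add(2) interval by (intro arg_cong2[of _ _ _ _ "(-)"] sum.cong refl) (simp add: L_pow)
  show ?thesis
    unfolding s_inv(2) z_inv(2) P_inv(2) N_def[symmetric] G_def[symmetric] Kd_def[symmetric]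
      Gd[symmetric] Gpi[symmetric]
    by (intro conjI P_inv s_inv z_inv Q1 Q2 Md)
qed

end
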